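(* Let $p$ be a prime and let $(K,v)$ be a roughly deeply ramified valued field of mixed characteristic $(0,p)$. Then for every $n\geq 1$, every $\mathcal{L}_{\mathrm{Witt}}$-definable subset of $(\mathcal{O}_v/(p))^n$ is $\mathcal{L}_{\mathrm{ring}}(\mathcal{O}_v/(p))$-definable, i.e. definable in the ring $\mathcal{O}_v/(p)$ by an $\mathcal{L}_{\mathrm{ring}}$-formula with parameters from $\mathcal{O}_v/(p)$.
   Context: For a valued field $(K,v)$, $\mathcal{O}_v$ is the valuation ring, $vK$ the value group, and $\mathcal{O}_v/(p^n)=\mathcal{O}_v/p^n\mathcal{O}_v$. A valued field of mixed characteristic $(0,p)$ (characteristic $0$ with residue field of characteristic $p$) is roughly deeply ramified if the Frobenius $x\mapsto x^p$ on $\mathcal{O}_v/(p)$ is surjective and $v(p)$ is not the smallest positive element of $vK$. $\mathcal{L}_{\mathrm{ring}}=\{+,\cdot,-,0,1\}$. For $n\ge 0$ the Witt polynomial is $W_n=\sum_{i=0}^n p^iX_i^{p^{n-i}}\in\mathbb{Z}[X_0,\dots,X_n]$. For $n\ge1$, define $$\omega_n\colon(\mathcal{O}_v/(p))^n\to\mathcal{O}_v/(p^n),\quad (x_0+p\mathcal{O}_v,\dots,x_{n-1}+p\mathcal{O}_v)\mapsto W_{n-1}(x_0,\dots,x_{n-1})+p^n\mathcal{O}_v$$ (well defined). The language $\mathcal{L}_{\mathrm{Witt}}=\mathcal{L}_{\mathrm{ring}}\cup\{\ker_n:n\ge1\}$, with $\ker_n$ a $2n$-ary relation symbol, is interpreted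 on $\mathcal{O}_v/(p)$ by the usual ring structure together with $\ker_n=\{(\underline{x};\underline{y})\in(\mathcal{O}_v/(p))^n\times(\mathcal{O}_v/(p))^n:\omega_n(\underline{x})=\omega_n(\underline{y})\}$. *)

theory Defs
  imports "HOL-Algebra.QuotRing" "HOL-Computational_Algebra.Computational_Algebra"
begin

section \<open>Valued fields\<close>

text \<open>
  A (Krull) valuation on the field \<^typ>\<open>'k\<close> is a map on the nonzero elements, with values in an
  arbitrary linearly ordered abelian group, written additively.  The usual convention that the
  value of zero is infinity is implemented by never looking at \<open>v 0\<close>.  The map need not be onto:
  the value group is its image.
\<close>

definition valuation :: "('k::field \<Rightarrow> 'g::linordered_ab_group_add) \<Rightarrow> bool" where
  "valuation v \<longleftrightarrow>
     (\<forall>x y. x \<noteq> 0 \<longrightarrow> y \<noteq> 0 \<longrightarrow> v (x * y) = v x + v y) \<and>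
     (\<forall>x y. x \<noteq> 0 \<longrightarrow> y \<noteq> 0 \<longrightarrow> x + y \<noteq> 0 \<longrightarrow> min (v x) (v y) \<le> v (x + y))"

definition value_group :: "('k::field \<Rightarrow> 'g::linordered_ab_group_add) \<Rightarrow> 'g set" where
  "value_group v = v ` (UNIV - {0})"

definition val_ring :: "('k::field \<Rightarrow> 'g::linordered_ab_group_add) \<Rightarrow> 'k ring" where
  "val_ring v = \<lparr>carrier = {x. x = 0 \<or> 0 \<le> v x}, monoid.mult = (*), one = 1, zero = 0, add = (+)\<rparr>"

definition max_ideal :: "('k::field \<Rightarrow> 'g::linordered_ab_group_add) \<Rightarrow> 'k set" where
  "max_ideal v = {x. x = 0 \<or> 0 < v x}"

definition residue_field :: "('k::field \<Rightarrow> 'g::linordered_ab_group_add) \<Rightarrow> 'k set ring" where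
  "residue_field v = val_ring v Quot max_ideal v"

definition val_ring_mod ::
    "('k::field \<Rightarrow> 'g::linordered_ab_group_add) \<Rightarrow> 'k \<Rightarrow> 'k set ring" where
  "val_ring_mod v a = val_ring v Quot (PIdl\<^bsub>val_ring v\<^esub> a)"

text \<open>The counterpart of \<^const>\<open>semiring_char\<close> for rings with a carrier.\<close>

definition ring_characteristic :: "('a, 'm) ring_scheme \<Rightarrow> nat" where
  "ring_characteristic R = Gcd {n. [n] \<cdot>\<^bsub>R\<^esub> \<one>\<^bsub>R\<^esub> = \<zero>\<^bsub>R\<^esub>}"

definition mixed_characteristic ::
    "('k::field \<Rightarrow> 'g::linordered_ab_group_add) \<Rightarrow> nat \<Rightarrow> bool" where
  "mixed_characteristic v p \<longleftrightarrow> CHAR('k) = 0 \<and> ring_characteristic (residue_field v) = p"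

definition smallest_positive_value ::
    "('k::field \<Rightarrow> 'g::linordered_ab_group_add) \<Rightarrow> 'g \<Rightarrow> bool" where
  "smallest_positive_value v \<gamma> \<longleftrightarrow>
     \<gamma> \<in> value_group v \<and> 0 < \<gamma> \<and> (\<forall>\<delta>\<in>value_group v. 0 < \<delta> \<longrightarrow> \<gamma> \<le> \<delta>)"

definition roughly_deeply_ramified ::
    "('k::field \<Rightarrow> 'g::linordered_ab_group_add) \<Rightarrow> nat \<Rightarrow> bool" where
  "roughly_deeply_ramified v p \<longleftrightarrow>
     (\<lambda>x. x [^]\<^bsub>val_ring_mod v (of_nat p)\<^esub> p) ` carrier (val_ring_mod v (of_nat p))
       = carrier (val_ring_mod v (of_nat p)) \<and>
     \<not> smallest_positive_value v (v (of_nat p))"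


section \<open>Witt polynomials and the maps \<open>\<omega>\<^sub>n\<close>\<close>

text \<open>The evaluation of the Witt polynomial \<open>W\<^sub>n\<close> at the point \<open>(x 0, \<dots>, x n)\<close>.\<close>

definition witt_poly :: "nat \<Rightarrow> nat \<Rightarrow> (nat \<Rightarrow> 'a::comm_ring_1) \<Rightarrow> 'a" where
  "witt_poly p n x = (\<Sum>i\<le>n. of_nat p ^ i * x i ^ (p ^ (n - i)))"

text \<open>
  Tuples are lists.  The definite description ranges over all choices \<open>x\<close> of representatives of
  the residue classes \<open>X ! i\<close>; that the result does not depend on this choice, so that
  \<open>witt_map\<close> is the map one expects, is \<open>witt_map_eq\<close> below.  Only \<open>n \<ge> 1\<close> is meaningful.
\<close>

definition witt_map ::
    "('k::field \<Rightarrow> 'g::linordered_ab_group_add) \<Rightarrow> nat \<Rightarrow> nat \<Rightarrow> 'k set list \<Rightarrow> 'k set" where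
  "witt_map v p n X =
     (THE Y. \<exists>x. (\<forall>i<n. x i \<in> carrier (val_ring v) \<and>
                      X ! i = PIdl\<^bsub>val_ring v\<^esub> (of_nat p) +>\<^bsub>val_ring v\<^esub> x i) \<and>
                 Y = PIdl\<^bsub>val_ring v\<^esub> (of_nat p ^ n) +>\<^bsub>val_ring v\<^esub> witt_poly p (n - 1) x)"


section \<open>First-order logic\<close>

datatype 'f fo_term = Var nat | App 'f "'f fo_term list"

datatype ('f, 'r) fo_formula =
    Eq "'f fo_term" "'f fo_term"
  | Rel 'r "'f fo_term list"
  | Neg "('f, 'r) fo_formula"
  | Conj "('f, 'r) fo_formula" "('f, 'r) fo_formula"
  | Exi nat "('f, 'r) fo_formula"

text \<open>A language is a set of function symbols and a set of relation symbols, with their arities.\<close>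

record ('f, 'r) language =
  fun_syms :: "('f \<times> nat) set"
  rel_syms :: "('r \<times> nat) set"

primrec term_vars :: "'f fo_term \<Rightarrow> nat set" where
  "term_vars (Var i) = {i}"
| "term_vars (App f ts) = \<Union> (set (map term_vars ts))"

primrec free_vars :: "('f, 'r) fo_formula \<Rightarrow> nat set" where
  "free_vars (Eq s t) = term_vars s \<union> term_vars t"
| "free_vars (Rel r ts) = \<Union> (set (map term_vars ts))"
| "free_vars (Neg \<phi>) = free_vars \<phi>"
| "free_vars (Conj \<phi> \<psi>) = free_vars \<phi> \<union> free_vars \<psi>"
| "free_vars (Exi i \<phi>) = free_vars \<phi> - {i}"

primrec wf_term :: "('f, 'r) language \<Rightarrow> 'f fo_term \<Rightarrow> bool" where
  "wf_term L (Var i) \<longleftrightarrow> True"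
| "wf_term L (App f ts) \<longleftrightarrow> (f, length ts) \<in> fun_syms L \<and> list_all (\<lambda>b. b) (map (wf_term L) ts)"

primrec wf_formula :: "('f, 'r) language \<Rightarrow> ('f, 'r) fo_formula \<Rightarrow> bool" where
  "wf_formula L (Eq s t) \<longleftrightarrow> wf_term L s \<and> wf_term L t"
| "wf_formula L (Rel r ts) \<longleftrightarrow> (r, length ts) \<in> rel_syms L \<and> list_all (wf_term L) ts"
| "wf_formula L (Neg \<phi>) \<longleftrightarrow> wf_formula L \<phi>"
| "wf_formula L (Conj \<phi> \<psi>) \<longleftrightarrow> wf_formula L \<phi> \<and> wf_formula L \<psi>"
| "wf_formula L (Exi i \<phi>) \<longleftrightarrow> wf_formula L \<phi>"

record ('f, 'r, 'a) fo_structure =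
  universe :: "'a set"
  fun_interp :: "'f \<Rightarrow> 'a list \<Rightarrow> 'a"
  rel_interp :: "'r \<Rightarrow> 'a list \<Rightarrow> bool"

primrec eval_term :: "('f, 'r, 'a) fo_structure \<Rightarrow> (nat \<Rightarrow> 'a) \<Rightarrow> 'f fo_term \<Rightarrow> 'a" where
  "eval_term M e (Var i) = e i"
| "eval_term M e (App f ts) = fun_interp M f (map (eval_term M e) ts)"

primrec sat :: "('f, 'r, 'a) fo_structure \<Rightarrow> (nat \<Rightarrow> 'a) \<Rightarrow> ('f, 'r) fo_formula \<Rightarrow> bool" where
  "sat M e (Eq s t) \<longleftrightarrow> eval_term M e s = eval_term M e t"
| "sat M e (Rel r ts) \<longleftrightarrow> rel_interp M r (map (eval_term M e) ts)"
| "sat M e (Neg \<phi>) \<longleftrightarrow> \<not> sat M e \<phi>"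
| "sat M e (Conj \<phi> \<psi>) \<longleftrightarrow> sat M e \<phi> \<and> sat M e \<psi>"
| "sat M e (Exi i \<phi>) \<longleftrightarrow> (\<exists>a\<in>universe M. sat M (e(i := a)) \<phi>)"

text \<open>
  \<open>definable L M A n S\<close>: the set \<open>S\<close> of \<open>n\<close>-tuples is \<open>L(A)\<close>-definable in \<open>M\<close>.  The variables
  \<open>0, \<dots>, n - 1\<close> stand for the tuple and the variables from \<open>n\<close> on for the parameters \<open>bs\<close> from
  \<open>A\<close>; definability without parameters is the case \<open>A = {}\<close>.
\<close>

definition definable ::
    "('f, 'r) language \<Rightarrow> ('f, 'r, 'a) fo_structure \<Rightarrow> 'a set \<Rightarrow> nat \<Rightarrow> 'a list set \<Rightarrow> bool" where
  "definable L M A n S \<longleftrightarrow>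
     (\<exists>\<phi> bs. wf_formula L \<phi> \<and> set bs \<subseteq> A \<and> free_vars \<phi> \<subseteq> {..<n + length bs} \<and>
        S = {xs. length xs = n \<and> set xs \<subseteq> universe M \<and> sat M (\<lambda>i. (xs @ bs) ! i) \<phi>})"


section \<open>The languages of rings and of truncated Witt vectors\<close>

datatype ring_sym = Plus | Times | Minus | Zero | One

datatype witt_sym = Ker nat

text \<open>\<open>Minus\<close> is the unary additive inverse.\<close>

definition L_ring :: "(ring_sym, witt_sym) language" where
  "L_ring = \<lparr>fun_syms = {(Plus, 2), (Times, 2), (Minus, 1), (Zero, 0), (One, 0)}, rel_syms = {}\<rparr>"

definition L_Witt :: "(ring_sym, witt_sym) language" where
  "L_Witt = L_ring\<lparr>rel_syms := {(Ker n, 2 * n) |n. n \<ge> 1}\<rparr>"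

primrec ring_fun_interp :: "('a, 'm) ring_scheme \<Rightarrow> ring_sym \<Rightarrow> 'a list \<Rightarrow> 'a" where
  "ring_fun_interp R Plus = (\<lambda>xs. xs ! 0 \<oplus>\<^bsub>R\<^esub> xs ! 1)"
| "ring_fun_interp R Times = (\<lambda>xs. xs ! 0 \<otimes>\<^bsub>R\<^esub> xs ! 1)"
| "ring_fun_interp R Minus = (\<lambda>xs. \<ominus>\<^bsub>R\<^esub> xs ! 0)"
| "ring_fun_interp R Zero = (\<lambda>xs. \<zero>\<^bsub>R\<^esub>)"
| "ring_fun_interp R One = (\<lambda>xs. \<one>\<^bsub>R\<^esub>)"

text \<open>
  The relation symbols are not in \<open>L_ring\<close>, so their interpretation in the structure below is a
  dummy, never consulted by a well-formed formula.
\<close>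

definition ring_structure ::
    "('a, 'm) ring_scheme \<Rightarrow> (ring_sym, witt_sym, 'a) fo_structure" where
  "ring_structure R =
     \<lparr>universe = carrier R, fun_interp = ring_fun_interp R, rel_interp = (\<lambda>_ _. False)\<rparr>"

primrec ker_rel ::
    "('k::field \<Rightarrow> 'g::linordered_ab_group_add) \<Rightarrow> nat \<Rightarrow> witt_sym \<Rightarrow> 'k set list \<Rightarrow> bool" where
  "ker_rel v p (Ker n) = (\<lambda>zs. witt_map v p n (take n zs) = witt_map v p n (drop n zs))"

definition witt_structure ::
    "('k::field \<Rightarrow> 'g::linordered_ab_group_add) \<Rightarrow> nat \<Rightarrow>
      (ring_sym, witt_sym, 'k set) fo_structure" where
  "witt_structure v p =
     (ring_structure (val_ring_mod v (of_nat p)))\<lparr>rel_interp := ker_rel v p\<rparr>"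


section \<open>Well-definedness\<close>

lemma val_ring_simps [simp]:
  "carrier (val_ring v) = {x. x = 0 \<or> 0 \<le> v x}"
  "x \<otimes>\<^bsub>val_ring v\<^esub> y = x * y" "x \<oplus>\<^bsub>val_ring v\<^esub> y = x + y"
  "\<one>\<^bsub>val_ring v\<^esub> = 1" "\<zero>\<^bsub>val_ring v\<^esub> = 0"
  by (simp_all add: val_ring_def)

lemma valuation_one:
  assumes "valuation v"
  shows "v 1 = 0"
proof -
  have "v (1 * 1) = v 1 + v 1"
    using assms unfolding valuation_def by (metis zero_neq_one)
  then show ?thesis by simp
qed

lemma valuation_minus:
  assumes v: "valuation v"
  shows "v (- x) = v x"
proof (cases "x = 0")
  case False
  have "v ((-1) * (-1)) = v (-1) + v (-1)"
    using v unfolding valuation_def by (metis neg_equal_0_iff_equal zero_neq_one)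
  then have "v (-1) + v (-1) = 0" using valuation_one[OF v] by simp
  then have "v (-1) = 0" by simp
  moreover have "v ((-1) * x) = v (-1) + v x"
    using v False unfolding valuation_def by (metis neg_equal_0_iff_equal zero_neq_one)
  ultimately show ?thesis by simp
qed simp

lemma val_ring_mult:
  assumes "valuation v" "x \<in> carrier (val_ring v)" "y \<in> carrier (val_ring v)"
  shows "x * y \<in> carrier (val_ring v)"
proof (cases "x = 0 \<or> y = 0")
  case False
  then have "v (x * y) = v x + v y" using assms(1) unfolding valuation_def by blast
  then show ?thesis using False assms(2,3) by simp
qed auto

lemma val_ring_add:
  assumes "valuation v" "x \<in> carrier (val_ring v)" "y \<in> carrier (val_ring v)"
  shows "x + y \<in> carrier (val_ring v)"
proof (cases "x = 0 \<or> y = 0 \<or> x + y = 0")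
  case False
  then have "min (v x) (v y) \<le> v (x + y)" "0 \<le> min (v x) (v y)"
    using assms unfolding valuation_def by auto
  then have "0 \<le> v (x + y)" by (rule order_trans[rotated])
  then show ?thesis by simp
qed (use assms in auto)

lemma val_ring_uminus:
  assumes "valuation v" "x \<in> carrier (val_ring v)"
  shows "- x \<in> carrier (val_ring v)"
  using assms by (simp add: valuation_minus)

lemma cring_val_ring:
  assumes v: "valuation v"
  shows "cring (val_ring v)"
proof (rule cringI)
  show "abelian_group (val_ring v)"
  proof (rule abelian_groupI)
    fix x assume "x \<in> carrier (val_ring v)"
    then show "\<exists>y\<in>carrier (val_ring v). y \<oplus>\<^bsub>val_ring v\<^esub> x = \<zero>\<^bsub>val_ring v\<^esub>"
      using val_ring_uminus[OF v, of x] by (intro bexI[of _ "- x"]) simp_all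
  qed (use val_ring_add[OF v] in \<open>simp_all add: algebra_simps\<close>)
  show "comm_monoid (val_ring v)"
    by (rule comm_monoidI)
       (use val_ring_mult[OF v] valuation_one[OF v] in \<open>simp_all add: algebra_simps\<close>)
qed (simp add: algebra_simps)

lemma cring_val_ring_mod:
  assumes v: "valuation v" and a: "a \<in> carrier (val_ring v)"
  shows "cring (val_ring_mod v a)"
proof -
  interpret cring "val_ring v" by (rule cring_val_ring[OF v])
  show ?thesis unfolding val_ring_mod_def
    by (rule ideal.quotient_is_cring[OF cgenideal_ideal[OF a] is_cring])
qed

lemma val_ring_of_nat:
  assumes "valuation v"
  shows "of_nat n \<in> carrier (val_ring v)"
proof (induction n)
  case (Suc n)
  have "1 \<in> carrier (val_ring v)" using valuation_one[OF assms] by simp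
  from val_ring_add[OF assms this Suc] show ?case by simp
qed simp

lemma val_ring_power:
  assumes "valuation v" "x \<in> carrier (val_ring v)"
  shows "x ^ n \<in> carrier (val_ring v)"
proof (induction n)
  case 0
  show ?case using valuation_one[OF assms(1)] by simp
next
  case (Suc n)
  from val_ring_mult[OF assms this] show ?case by simp
qed

lemma val_ring_sum:
  assumes "valuation v" "\<And>i. i \<in> A \<Longrightarrow> f i \<in> carrier (val_ring v)"
  shows "sum f A \<in> carrier (val_ring v)"
  using assms(2)
proof (induction A rule: infinite_finite_induct)
  case (insert i A)
  then show ?case using val_ring_add[OF assms(1), of "f i" "sum f A"] by (simp del: val_ring_simps)
qed simp_all

lemma coset_eq_iff:
  assumes v: "valuation v" and a: "a \<in> carrier (val_ring v)"
    and x: "x \<in> carrier (val_ring v)" and y: "y \<in> carrier (val_ring v)"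
  shows "PIdl\<^bsub>val_ring v\<^esub> a +>\<^bsub>val_ring v\<^esub> x = PIdl\<^bsub>val_ring v\<^esub> a +>\<^bsub>val_ring v\<^esub> y \<longleftrightarrow>
         (\<exists>c\<in>carrier (val_ring v). x = y + a * c)"
proof -
  interpret cring "val_ring v" by (rule cring_val_ring[OF v])
  interpret I: ideal "PIdl\<^bsub>val_ring v\<^esub> a" "val_ring v" by (rule cgenideal_ideal[OF a])
  have "PIdl\<^bsub>val_ring v\<^esub> a +>\<^bsub>val_ring v\<^esub> x = PIdl\<^bsub>val_ring v\<^esub> a +>\<^bsub>val_ring v\<^esub> y \<longleftrightarrow>
        x \<in> PIdl\<^bsub>val_ring v\<^esub> a +>\<^bsub>val_ring v\<^esub> y"
    using x y by (metis I.a_repr_independence' I.a_rcos_self)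
  also have "\<dots> \<longleftrightarrow> (\<exists>c\<in>carrier (val_ring v). x = y + a * c)"
    by (auto simp: a_r_coset_def' cgenideal_def algebra_simps)
  finally show ?thesis .
qed

lemma val_ring_power_cong:
  assumes v: "valuation v" and p: "prime p"
    and y: "y \<in> carrier (val_ring v)" and c: "c \<in> carrier (val_ring v)"
  shows "\<exists>d\<in>carrier (val_ring v). (y + of_nat p * c) ^ p ^ k = y ^ p ^ k + of_nat p ^ Suc k * d"
proof (induction k)
  case 0
  show ?case using c by auto
next
  case (Suc k)
  then obtain d where d: "d \<in> carrier (val_ring v)"
    and eq: "(y + of_nat p * c) ^ p ^ k = y ^ p ^ k + of_nat p ^ Suc k * d" by blast
  define P :: 'a where "P = of_nat p"
  define z where "z = y ^ p ^ k"
  define q where "q = P ^ Suc k * d"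
  have P: "P \<in> carrier (val_ring v)" unfolding P_def by (rule val_ring_of_nat[OF v])
  have z: "z \<in> carrier (val_ring v)" unfolding z_def by (rule val_ring_power[OF v y])
  have q: "q \<in> carrier (val_ring v)"
    unfolding q_def by (rule val_ring_mult[OF v val_ring_power[OF v P] d])
  have p2: "p \<ge> 2" using p by (rule prime_ge_2_nat)
  define g where "g j = (if j = 1 then z ^ (p - 1) * d
      else if j < p then of_nat ((p choose j) div p) * q ^ (j - 1) * z ^ (p - j) * d
      else P ^ (Suc k * p - (k + 2)) * d ^ p)" for j
  have g: "g j \<in> carrier (val_ring v)" for j
    unfolding g_def
    by (auto simp del: val_ring_simps
        intro!: val_ring_mult[OF v] val_ring_power[OF v] val_ring_of_nat[OF v] z q d P)
  have term_eq: "of_nat (p choose j) * q ^ j * z ^ (p - j) = P ^ (k + 2) * g j"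
    if j: "j \<in> {1..p}" for j
  proof -
    consider "j = 1" | "1 < j" "j < p" | "1 < j" "j = p" using j p2 by force
    then show ?thesis
    proof cases
      case 1
      then show ?thesis by (simp add: g_def q_def P_def algebra_simps)
    next
      case 2
      have "p dvd p choose j" using dvd_choose_prime[of j p] 2 p by auto
      then have ch: "of_nat (p choose j) = P * of_nat ((p choose j) div p)"
        unfolding P_def by (metis dvd_mult_div_cancel of_nat_mult)
      have "q ^ j = P ^ Suc k * d * q ^ (j - 1)"
        using 2 by (metis q_def power_eq_if not_less_zero)
      then show ?thesis using 2 unfolding ch by (simp add: g_def algebra_simps)
    next
      case 3
      have "k + 2 \<le> Suc k * 2" by simp
      also have "\<dots> \<le> Suc k * p" using p2 by (rule mult_le_mono2)
      finally have "P ^ (Suc k * p) = P ^ (k + 2) * P ^ (Suc k * p - (k + 2))"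
        by (metis le_add_diff_inverse power_add)
      then have "q ^ p = P ^ (k + 2) * P ^ (Suc k * p - (k + 2)) * d ^ p"
        unfolding q_def by (metis power_mult power_mult_distrib)
      then show ?thesis using 3 by (simp add: g_def algebra_simps)
    qed
  qed
  have "(y + of_nat p * c) ^ p ^ Suc k = (q + z) ^ p"
    using eq by (simp add: power_mult mult.commute[of p] q_def z_def P_def add.commute)
  also have "\<dots> = (\<Sum>j\<le>p. of_nat (p choose j) * q ^ j * z ^ (p - j))"
    by (rule binomial_ring)
  also have "{..p} = insert 0 {1..p}" by auto
  also have "(\<Sum>j\<in>insert 0 {1..p}. of_nat (p choose j) * q ^ j * z ^ (p - j))
      = z ^ p + (\<Sum>j\<in>{1..p}. P ^ (k + 2) * g j)"
    using term_eq by simp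
  also have "\<dots> = y ^ p ^ Suc k + of_nat p ^ Suc (Suc k) * (\<Sum>j\<in>{1..p}. g j)"
    by (simp add: sum_distrib_left z_def power_mult mult.commute[of p] P_def)
  finally show ?case using val_ring_sum[OF v, of "{1..p}" g] g by blast
qed

lemma witt_map_eq:
  assumes v: "valuation v" and p: "prime p" and n: "n \<ge> 1"
    and x: "\<And>i. i < n \<Longrightarrow> x i \<in> carrier (val_ring v)"
    and X: "\<And>i. i < n \<Longrightarrow> X ! i = PIdl\<^bsub>val_ring v\<^esub> (of_nat p) +>\<^bsub>val_ring v\<^esub> x i"
  shows "witt_map v p n X
    = PIdl\<^bsub>val_ring v\<^esub> (of_nat p ^ n) +>\<^bsub>val_ring v\<^esub> witt_poly p (n - 1) x"
  unfolding witt_map_def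
proof (rule the_equality)
  show "\<exists>x'. (\<forall>i<n. x' i \<in> carrier (val_ring v) \<and>
            X ! i = PIdl\<^bsub>val_ring v\<^esub> (of_nat p) +>\<^bsub>val_ring v\<^esub> x' i) \<and>
          PIdl\<^bsub>val_ring v\<^esub> (of_nat p ^ n) +>\<^bsub>val_ring v\<^esub> witt_poly p (n - 1) x
            = PIdl\<^bsub>val_ring v\<^esub> (of_nat p ^ n) +>\<^bsub>val_ring v\<^esub> witt_poly p (n - 1) x'"
    using x X by blast
next
  fix Y
  assume "\<exists>x'. (\<forall>i<n. x' i \<in> carrier (val_ring v) \<and>
            X ! i = PIdl\<^bsub>val_ring v\<^esub> (of_nat p) +>\<^bsub>val_ring v\<^esub> x' i) \<and>
          Y = PIdl\<^bsub>val_ring v\<^esub> (of_nat p ^ n) +>\<^bsub>val_ring v\<^esub> witt_poly p (n - 1) x'"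
  then obtain x' where x': "\<And>i. i < n \<Longrightarrow> x' i \<in> carrier (val_ring v)"
    and X': "\<And>i. i < n \<Longrightarrow> X ! i = PIdl\<^bsub>val_ring v\<^esub> (of_nat p) +>\<^bsub>val_ring v\<^esub> x' i"
    and Y: "Y = PIdl\<^bsub>val_ring v\<^esub> (of_nat p ^ n) +>\<^bsub>val_ring v\<^esub> witt_poly p (n - 1) x'"
    by blast
  have "\<exists>d\<in>carrier (val_ring v). of_nat p ^ i * x' i ^ p ^ (n - 1 - i)
          = of_nat p ^ i * x i ^ p ^ (n - 1 - i) + of_nat p ^ n * d" if i: "i < n" for i
  proof -
    obtain c where c: "c \<in> carrier (val_ring v)" "x' i = x i + of_nat p * c"
      using coset_eq_iff[OF v val_ring_of_nat[OF v] x'[OF i] x[OF i]] X[OF i] X'[OF i] by metis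
    obtain d where d: "d \<in> carrier (val_ring v)"
      "x' i ^ p ^ (n - 1 - i) = x i ^ p ^ (n - 1 - i) + of_nat p ^ Suc (n - 1 - i) * d"
      using val_ring_power_cong[OF v p x[OF i] c(1)] c(2) by metis
    have "(of_nat p :: 'a) ^ n = of_nat p ^ i * of_nat p ^ Suc (n - 1 - i)"
      using i by (simp flip: power_add power_Suc)
    then show ?thesis using d by (intro bexI[of _ d]) (simp_all add: algebra_simps)
  qed
  then obtain d where d: "\<And>i. i < n \<Longrightarrow> d i \<in> carrier (val_ring v)"
    "\<And>i. i < n \<Longrightarrow> of_nat p ^ i * x' i ^ p ^ (n - 1 - i)
          = of_nat p ^ i * x i ^ p ^ (n - 1 - i) + of_nat p ^ n * d i" by metis
  have "witt_poly p (n - 1) x' = witt_poly p (n - 1) x + of_nat p ^ n * (\<Sum>i\<le>n - 1. d i)"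
    unfolding witt_poly_def sum_distrib_left sum.distrib[symmetric]
    by (rule sum.cong) (use d(2) n in auto)
  moreover have "(\<Sum>i\<le>n - 1. d i) \<in> carrier (val_ring v)"
    by (rule val_ring_sum[OF v]) (use d(1) n in auto)
  moreover have "witt_poly p (n - 1) y \<in> carrier (val_ring v)"
    if "\<And>i. i < n \<Longrightarrow> y i \<in> carrier (val_ring v)" for y
    unfolding witt_poly_def
    by (rule val_ring_sum[OF v])
       (use that n in \<open>auto simp del: val_ring_simps
          intro!: val_ring_mult[OF v] val_ring_power[OF v] val_ring_of_nat[OF v]\<close>)
  ultimately show "Y = PIdl\<^bsub>val_ring v\<^esub> (of_nat p ^ n) +>\<^bsub>val_ring v\<^esub> witt_poly p (n - 1) x"
    unfolding Y
    using coset_eq_iff[OF v val_ring_power[OF v val_ring_of_nat[OF v]]] x x' by blast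
qed

end

theory Submission
  imports Defs
begin

text \<open>
  Write \<open>\<O>\<close> for the valuation ring, \<open>R = \<O>/(p)\<close> and
  \<open>\<omega>\<^sub>n(x) = \<Sum>i<n. p\<^sup>i x\<^sub>i ^ p ^ (n - 1 - i)\<close> modulo \<open>p\<^sup>n\<close>.  Everything rests on one fact: for
  each \<open>n\<close>, and all tuples \<open>x\<close>, \<open>y\<close> of polynomial functions, the relation
  \<open>\<omega>\<^sub>n(x) = \<omega>\<^sub>n(y)\<close> is expressed by a formula in the ring \<open>R\<close> with parameters
  (\<open>ring_definable_ghost_pcong\<close>).  Given this, a formula with symbols \<open>ker\<^sub>n\<close> is translated by
  replacing its atoms one by one (\<open>translation\<close>).

  The fact is proved by induction on \<open>n\<close>.  Put \<open>q = p\<^sup>n\<close>, so that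
  \<open>\<omega>\<close> at level \<open>n + 1\<close> sends \<open>x\<close> to \<open>x\<^sub>0 ^ q + p \<omega>\<^sub>n(x')\<close>, where \<open>x'\<close> is the tail of \<open>x\<close>.  As the
  Frobenius is surjective and \<open>v p\<close> is not the smallest positive value, there are \<open>w\<close> and a unit
  \<open>u\<close> in \<open>\<O>\<close> with \<open>w ^ q = p u\<close> (\<open>root_of_p\<close>).  If \<open>x\<close> and \<open>y\<close> have the same image, then \<open>p\<close>
  divides \<open>x\<^sub>0 ^ q - y\<^sub>0 ^ q\<close>, hence \<open>(x\<^sub>0 - y\<^sub>0) ^ q\<close>, and comparing values gives
  \<open>x\<^sub>0 = y\<^sub>0 + w z\<close> for some \<open>z\<close>.  For such a \<open>z\<close> the
  difference of the leading terms is divisible by \<open>p\<close>, and after dividing by \<open>p\<close> the equation becomes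
  \<open>u z ^ q + carry(y\<^sub>0, w z) + \<omega>\<^sub>n(x') = \<omega>\<^sub>n(y')\<close> modulo \<open>p\<^sup>n\<close>, where
  \<open>carry(a, b) = ((a + b) ^ q - a ^ q - b ^ q) / p\<close> (\<open>ghost_pcong_Suc_iff\<close>).  So the relation at
  level \<open>n + 1\<close> says that some \<open>z\<close> in \<open>R\<close> satisfies a ring equation and an equation at level \<open>n\<close>.

  For the induction to apply, the left hand side has to be \<open>\<omega>\<^sub>n\<close> of a tuple of polynomials in the
  variables and \<open>z\<close>.  Functions of this form are called representable below.  They are closed
  under addition (\<open>representable_add\<close>), which amounts to saying that the addition of Witt vectors
  is polynomial; they contain \<open>carry\<close> because the coefficient of \<open>a ^ j b ^ (q - j)\<close> in it is
  divisible by just the right power of \<open>p\<close>; and they contain \<open>u z ^ q\<close> because, by surjectivity of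
  the Frobenius, \<open>u\<close> itself is in the image of \<open>\<omega>\<^sub>n\<close>.  The parameters of the
  resulting formula are thus the classes of \<open>w\<close> and of the Witt coordinates of \<open>u\<close>, for each level.
\<close>

section \<open>Formulas with constants\<close>

text \<open>
  Formulas with parameters are easiest to build when the parameters are constant symbols: no variable
  has to be reserved for them, and formulas with different parameters can be combined freely.  The
  constants are turned into variables, as \<^const>\<open>definable\<close> wants it, once at the end.
\<close>

definition with_consts :: "('f, 'r) language \<Rightarrow> 'a set \<Rightarrow> ('f + 'a, 'r) language" where
  "with_consts L A =
     \<lparr>fun_syms = {(Inl f, k) |f k. (f, k) \<in> fun_syms L} \<union> {(Inr a, 0) |a. a \<in> A}, rel_syms = rel_syms L\<rparr>"

definition expand :: "('f, 'r, 'a) fo_structure \<Rightarrow> ('f + 'a, 'r, 'a) fo_structure" where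
  "expand M = \<lparr>universe = universe M, fun_interp = case_sum (fun_interp M) (\<lambda>a _. a),
     rel_interp = rel_interp M\<rparr>"

lemma with_consts_simps [simp]:
  "(Inl f, k) \<in> fun_syms (with_consts L A) \<longleftrightarrow> (f, k) \<in> fun_syms L"
  "(Inr a, k) \<in> fun_syms (with_consts L A) \<longleftrightarrow> a \<in> A \<and> k = 0"
  "rel_syms (with_consts L A) = rel_syms L"
  by (auto simp: with_consts_def)

lemma expand_simps [simp]:
  "universe (expand M) = universe M"
  "fun_interp (expand M) (Inl f) = fun_interp M f"
  "fun_interp (expand M) (Inr a) ts = a"
  "rel_interp (expand M) = rel_interp M"
  by (simp_all add: expand_def)

text \<open>
  Here \<open>s\<close> renames the variables, bound ones included, to make room for the variables \<open>k a\<close> that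
  replace the constants \<open>a\<close>.
\<close>

primrec elim_term :: "(nat \<Rightarrow> nat) \<Rightarrow> ('a \<Rightarrow> nat) \<Rightarrow> ('f + 'a) fo_term \<Rightarrow> 'f fo_term" where
  "elim_term s k (Var i) = Var (s i)"
| "elim_term s k (App f ts) =
     (case f of Inl g \<Rightarrow> App g (map (elim_term s k) ts) | Inr a \<Rightarrow> Var (k a))"

primrec elim_formula ::
    "(nat \<Rightarrow> nat) \<Rightarrow> ('a \<Rightarrow> nat) \<Rightarrow> ('f + 'a, 'r) fo_formula \<Rightarrow> ('f, 'r) fo_formula" where
  "elim_formula s k (Eq t u) = Eq (elim_term s k t) (elim_term s k u)"
| "elim_formula s k (Rel r ts) = Rel r (map (elim_term s k) ts)"
| "elim_formula s k (Neg \<phi>) = Neg (elim_formula s k \<phi>)"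
| "elim_formula s k (Conj \<phi> \<psi>) = Conj (elim_formula s k \<phi>) (elim_formula s k \<psi>)"
| "elim_formula s k (Exi i \<phi>) = Exi (s i) (elim_formula s k \<phi>)"

lemma finite_set_fo_term: "finite (set_fo_term t)"
  by (induction t) auto

lemma finite_set1_fo_formula: "finite (set1_fo_formula \<phi>)"
  by (induction \<phi>) (auto simp: finite_set_fo_term)

lemma wf_elim_term: "wf_term (with_consts L A) t \<Longrightarrow> wf_term L (elim_term s k t)"
  by (induction t) (auto simp: list_all_iff split: sum.split)

lemma consts_term: "wf_term (with_consts L A) t \<Longrightarrow> Inr a \<in> set_fo_term t \<Longrightarrow> a \<in> A"
  by (induction t) (auto simp: list_all_iff)

lemma vars_elim_term:
  "term_vars (elim_term s k t) \<subseteq> s ` term_vars t \<union> k ` {a. Inr a \<in> set_fo_term t}"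
proof (induction t)
  case (App f ts)
  show ?case
  proof (cases f)
    case (Inl g)
    have "term_vars (elim_term s k t) \<subseteq> s ` term_vars (App f ts) \<union> k ` {a. Inr a \<in> set_fo_term (App f ts)}"
      if "t \<in> set ts" for t
      by (rule order_trans[OF App.IH[OF that]]) (use that in auto)
    then show ?thesis by (auto simp: Inl)
  qed auto
qed auto

lemma eval_elim_term:
  assumes "\<And>i. \<epsilon>' (s i) = \<epsilon> i" "\<And>a. Inr a \<in> set_fo_term t \<Longrightarrow> \<epsilon>' (k a) = a"
  shows "eval_term M \<epsilon>' (elim_term s k t) = eval_term (expand M) \<epsilon> t"
  using assms(2)
proof (induction t)
  case (App f ts)
  show ?case
  proof (cases f)
    case (Inl g)
    have "map (eval_term M \<epsilon>' \<circ> elim_term s k) ts = map (eval_term (expand M) \<epsilon>) ts"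
      using App by (auto simp: Bex_def)
    then show ?thesis by (simp add: Inl del: map_eq_conv)
  qed (use App.prems in auto)
qed (use assms(1) in auto)

lemma wf_elim_formula: "wf_formula (with_consts L A) \<phi> \<Longrightarrow> wf_formula L (elim_formula s k \<phi>)"
  by (induction \<phi>) (auto simp: list_all_iff wf_elim_term)

lemma consts_formula: "wf_formula (with_consts L A) \<phi> \<Longrightarrow> Inr a \<in> set1_fo_formula \<phi> \<Longrightarrow> a \<in> A"
  by (induction \<phi>) (auto simp: list_all_iff dest: consts_term)

lemma free_vars_elim_formula:
  "free_vars (elim_formula s k \<phi>) \<subseteq> s ` free_vars \<phi> \<union> k ` {a. Inr a \<in> set1_fo_formula \<phi>}"
proof (induction \<phi>)
  case (Eq t u)
  show ?case using vars_elim_term[of s k t] vars_elim_term[of s k u] by auto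
next
  case (Rel r ts)
  have "term_vars (elim_term s k t) \<subseteq> s ` free_vars (Rel r ts) \<union> k ` {a. Inr a \<in> set1_fo_formula (Rel r ts)}"
    if "t \<in> set ts" for t
    by (rule order_trans[OF vars_elim_term]) (use that in auto)
  then show ?case by auto
qed auto

lemma sat_elim_formula:
  assumes "inj s"
    and "\<And>i. \<epsilon>' (s i) = \<epsilon> i"
    and "\<And>a. Inr a \<in> set1_fo_formula \<phi> \<Longrightarrow> \<epsilon>' (k a) = a \<and> k a \<notin> range s"
  shows "sat M \<epsilon>' (elim_formula s k \<phi>) \<longleftrightarrow> sat (expand M) \<epsilon> \<phi>"
  using assms(2,3)
proof (induction \<phi> arbitrary: \<epsilon> \<epsilon>')
  case (Eq t u)
  have "eval_term M \<epsilon>' (elim_term s k t) = eval_term (expand M) \<epsilon> t"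
    "eval_term M \<epsilon>' (elim_term s k u) = eval_term (expand M) \<epsilon> u"
    by (rule eval_elim_term; use Eq.prems in auto)+
  then show ?case by simp
next
  case (Rel r ts)
  have "map (eval_term M \<epsilon>' \<circ> elim_term s k) ts = map (eval_term (expand M) \<epsilon>) ts"
  proof (rule map_cong[OF refl])
    fix t assume "t \<in> set ts"
    then show "(eval_term M \<epsilon>' \<circ> elim_term s k) t = eval_term (expand M) \<epsilon> t"
      unfolding comp_apply by (intro eval_elim_term) (use Rel.prems in auto)
  qed
  then show ?case by (simp del: map_eq_conv)
next
  case (Neg \<phi>)
  then show ?case by simp
next
  case (Conj \<phi> \<psi>)
  have "sat M \<epsilon>' (elim_formula s k \<phi>) \<longleftrightarrow> sat (expand M) \<epsilon> \<phi>"
    "sat M \<epsilon>' (elim_formula s k \<psi>) \<longleftrightarrow> sat (expand M) \<epsilon> \<psi>"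
    using Conj.prems by (auto intro!: Conj.IH)
  then show ?case by simp
next
  case (Exi i \<phi>)
  have "sat M (\<epsilon>'(s i := b)) (elim_formula s k \<phi>) \<longleftrightarrow> sat (expand M) (\<epsilon>(i := b)) \<phi>" for b
    by (rule Exi.IH) (use Exi.prems assms(1) in \<open>auto simp: inj_eq\<close>)
  then show ?case by simp
qed

text \<open>
  Variables from \<open>n\<close> on, which can only be bound ones, are shifted past the finite list of
  parameters, which takes the places \<open>n, n + 1, \<dots>\<close>.  The last hypothesis allows arbitrary values
  outside \<open>{..<n}\<close>, since the elements \<open>xs ! i\<close> with \<open>i \<ge> n\<close> are unspecified.
\<close>

lemma definable_of_formula_with_consts:
  assumes wf: "wf_formula (with_consts L A) \<phi>"
    and free: "free_vars \<phi> \<subseteq> {..<n}"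
    and S: "\<And>xs. xs \<in> S \<Longrightarrow> length xs = n \<and> set xs \<subseteq> universe M"
    and sat: "\<And>xs \<epsilon>. length xs = n \<Longrightarrow> set xs \<subseteq> universe M \<Longrightarrow> \<forall>i<n. \<epsilon> i = xs ! i \<Longrightarrow>
      sat (expand M) \<epsilon> \<phi> \<longleftrightarrow> xs \<in> S"
  shows "definable L M A n S"
proof -
  let ?C = "{a. Inr a \<in> set1_fo_formula \<phi>}"
  have "finite ?C"
    using finite_vimageI[OF finite_set1_fo_formula[of \<phi>], of Inr] by (simp add: vimage_def)
  then obtain bs where bs: "set bs = ?C" using finite_list by blast
  define s where "s i = (if i < n then i else i + length bs)" for i
  have "\<forall>a\<in>?C. \<exists>j<length bs. bs ! j = a" using bs by (metis in_set_conv_nth)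
  then obtain l where l: "\<And>a. a \<in> ?C \<Longrightarrow> l a < length bs \<and> bs ! l a = a" by metis
  define k where "k a = n + l a" for a
  let ?\<psi> = "elim_formula s k \<phi>"
  have "wf_formula L ?\<psi>" using wf by (rule wf_elim_formula)
  moreover have "set bs \<subseteq> A" using bs consts_formula[OF wf] by auto
  moreover have "free_vars ?\<psi> \<subseteq> {..<n + length bs}"
  proof -
    have "s ` free_vars \<phi> \<subseteq> {..<n + length bs}" using free by (auto simp: s_def)
    moreover have "k ` ?C \<subseteq> {..<n + length bs}" using l by (auto simp: k_def)
    ultimately show ?thesis using free_vars_elim_formula[of s k \<phi>] by blast
  qed
  moreover have "sat M (\<lambda>i. (xs @ bs) ! i) ?\<psi> \<longleftrightarrow> xs \<in> S"
    if xs: "length xs = n" "set xs \<subseteq> universe M" for xs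
  proof -
    have "sat M (\<lambda>i. (xs @ bs) ! i) ?\<psi> \<longleftrightarrow> sat (expand M) (\<lambda>i. (xs @ bs) ! s i) \<phi>"
    proof (rule sat_elim_formula)
      show "inj s" by (auto simp: inj_def s_def)
      show "(xs @ bs) ! k a = a \<and> k a \<notin> range s" if "Inr a \<in> set1_fo_formula \<phi>" for a
        using l[of a] that xs(1) by (auto simp: k_def s_def nth_append)
    qed simp
    also have "\<dots> \<longleftrightarrow> xs \<in> S"
      by (rule sat[OF xs]) (use xs(1) in \<open>auto simp: s_def nth_append\<close>)
    finally show ?thesis .
  qed
  ultimately show ?thesis
    unfolding definable_def using S by (intro exI[of _ ?\<psi>] exI[of _ bs]) blast
qed

section \<open>The valuation ring\<close>

text \<open>The carrier is kept folded: automation works with closure properties of the ring instead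
  of inequalities between values.\<close>

declare val_ring_simps(1) [simp del]

locale ramified_valued_field =
  fixes v :: "'k::field \<Rightarrow> 'g::linordered_ab_group_add" and p :: nat
  assumes val: "valuation v"
    and prime: "prime p"
    and p_nonzero: "of_nat p \<noteq> (0 :: 'k)"
    and ramified: "roughly_deeply_ramified v p"
begin

abbreviation \<O> :: "'k set" where "\<O> \<equiv> carrier (val_ring v)"
abbreviation P :: 'k where "P \<equiv> of_nat p"
abbreviation R :: "'k set ring" where "R \<equiv> val_ring_mod v P"
abbreviation \<pi> :: "'k \<Rightarrow> 'k set" where "\<pi> x \<equiv> PIdl\<^bsub>val_ring v\<^esub> P +>\<^bsub>val_ring v\<^esub> x"

lemma O_iff: "x \<in> \<O> \<longleftrightarrow> x = 0 \<or> 0 \<le> v x"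
  by (simp add: val_ring_simps(1))

lemma O_zero: "0 \<in> \<O>" and O_one: "1 \<in> \<O>"
  using valuation_one[OF val] by (simp_all add: O_iff)

lemmas O_closed [intro, simp] = O_zero O_one val_ring_add[OF val] val_ring_mult[OF val]
  val_ring_uminus[OF val] val_ring_power[OF val] val_ring_of_nat[OF val]

lemma O_diff [intro, simp]: "x \<in> \<O> \<Longrightarrow> y \<in> \<O> \<Longrightarrow> x - y \<in> \<O>"
  using O_closed(3)[of x "- y"] by simp

lemma O_sum [intro, simp]: "(\<And>i. i \<in> A \<Longrightarrow> f i \<in> \<O>) \<Longrightarrow> sum f A \<in> \<O>"
  by (rule val_ring_sum[OF val])

section \<open>Congruences\<close>

text \<open>
  All computations are made with
  representatives in the field, where one can divide by \<open>p\<close>.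
\<close>

definition pcong :: "nat \<Rightarrow> 'k \<Rightarrow> 'k \<Rightarrow> bool" where
  "pcong m a b \<longleftrightarrow> (\<exists>c\<in>\<O>. a = b + P ^ m * c)"

lemma pcong_refl [simp]: "pcong m a a"
  unfolding pcong_def by (rule bexI[of _ 0]) auto

lemma pcong_sym:
  assumes "pcong m a b"
  shows "pcong m b a"
proof -
  obtain c where "c \<in> \<O>" "a = b + P ^ m * c" using assms unfolding pcong_def by blast
  then show ?thesis unfolding pcong_def by (intro bexI[of _ "- c"]) auto
qed

lemma pcong_trans [trans]:
  assumes "pcong m a b" "pcong m b c"
  shows "pcong m a c"
proof -
  obtain s t where "s \<in> \<O>" "t \<in> \<O>" "a = b + P ^ m * s" "b = c + P ^ m * t"
    using assms unfolding pcong_def by blast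
  then show ?thesis unfolding pcong_def by (intro bexI[of _ "s + t"]) (auto simp: algebra_simps)
qed

lemma pcong_add: "pcong m a b \<Longrightarrow> pcong m c d \<Longrightarrow> pcong m (a + c) (b + d)"
proof -
  assume "pcong m a b" "pcong m c d"
  then obtain s t where "s \<in> \<O>" "t \<in> \<O>" "a = b + P ^ m * s" "c = d + P ^ m * t"
    unfolding pcong_def by blast
  then show ?thesis unfolding pcong_def by (intro bexI[of _ "s + t"]) (auto simp: algebra_simps)
qed

lemma pcong_mult_left: "c \<in> \<O> \<Longrightarrow> pcong m a b \<Longrightarrow> pcong m (c * a) (c * b)"
proof -
  assume c: "c \<in> \<O>" and "pcong m a b"
  then obtain s where "s \<in> \<O>" "a = b + P ^ m * s"
    unfolding pcong_def by blast
  then show ?thesis unfolding pcong_def using c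
    by (intro bexI[of _ "c * s"]) (auto simp: algebra_simps)
qed

lemma pcong_add_left_iff: "pcong m (c + a) (c + b) \<longleftrightarrow> pcong m a b"
  unfolding pcong_def by (simp add: add.assoc)

lemma pcong_Suc_iff: "pcong (Suc m) (P * a) (P * b) \<longleftrightarrow> pcong m a b"
proof -
  have "P * a = P * b + P ^ Suc m * c \<longleftrightarrow> a = b + P ^ m * c" for c
    using p_nonzero mult_left_cancel[of P a "b + P ^ m * c"] by (simp add: algebra_simps)
  then show ?thesis unfolding pcong_def by simp
qed

lemma pcong_0: "a \<in> \<O> \<Longrightarrow> b \<in> \<O> \<Longrightarrow> pcong 0 a b"
  unfolding pcong_def by (rule bexI[of _ "a - b"]) auto

lemma pcong_trans_iff: "pcong m a a' \<Longrightarrow> pcong m b b' \<Longrightarrow> pcong m a b \<longleftrightarrow> pcong m a' b'"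
  by (meson pcong_sym pcong_trans)

lemma pcong_le: "pcong m a b \<Longrightarrow> k \<le> m \<Longrightarrow> pcong k a b"
proof -
  assume "pcong m a b" and k: "k \<le> m"
  then obtain c where "c \<in> \<O>" "a = b + P ^ m * c" unfolding pcong_def by blast
  moreover have "P ^ m = P ^ k * P ^ (m - k)" using k by (simp flip: power_add)
  ultimately show ?thesis
    unfolding pcong_def by (intro bexI[of _ "P ^ (m - k) * c"]) (auto simp: mult.assoc)
qed

text \<open>
  Raising to the power \<open>p\<^sup>k\<close> gains \<open>k\<close> digits of precision.  This is why \<open>\<omega>\<^sub>n\<close>, with values modulo
  \<open>p\<^sup>n\<close>, only depends on its arguments modulo \<open>p\<close>.
\<close>

lemma pcong_power:
  "y \<in> \<O> \<Longrightarrow> pcong 1 x y \<Longrightarrow> pcong (Suc k) (x ^ p ^ k) (y ^ p ^ k)"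
  unfolding pcong_def using val_ring_power_cong[OF val prime, of y _ k] by auto

lemma pi_eq_iff: "x \<in> \<O> \<Longrightarrow> y \<in> \<O> \<Longrightarrow> \<pi> x = \<pi> y \<longleftrightarrow> pcong 1 x y"
  using coset_eq_iff[OF val O_closed(7)] by (simp add: pcong_def)

section \<open>The ring of residues modulo p\<close>

lemma pi_hom: "\<pi> \<in> ring_hom (val_ring v) R"
proof -
  interpret cring "val_ring v" by (rule cring_val_ring[OF val])
  show ?thesis unfolding val_ring_mod_def
    by (rule ideal.rcos_ring_hom[OF cgenideal_ideal]) simp
qed

lemma pi_ring_hom_cring: "ring_hom_cring (val_ring v) R \<pi>"
  by (intro ring_hom_cring.intro cring_val_ring cring_val_ring_mod val
      ring_hom_cring_axioms.intro pi_hom) simp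

lemma carrier_R: "carrier R = \<pi> ` \<O>"
  by (auto simp: val_ring_mod_def FactRing_def A_RCOSETS_def' )

lemma pi_add: "x \<in> \<O> \<Longrightarrow> y \<in> \<O> \<Longrightarrow> \<pi> x \<oplus>\<^bsub>R\<^esub> \<pi> y = \<pi> (x + y)"
  and pi_mult: "x \<in> \<O> \<Longrightarrow> y \<in> \<O> \<Longrightarrow> \<pi> x \<otimes>\<^bsub>R\<^esub> \<pi> y = \<pi> (x * y)"
  and pi_one: "\<one>\<^bsub>R\<^esub> = \<pi> 1"
  and pi_zero: "\<zero>\<^bsub>R\<^esub> = \<pi> 0"
  and pi_minus: "x \<in> \<O> \<Longrightarrow> \<ominus>\<^bsub>R\<^esub> \<pi> x = \<pi> (- x)"
  and pi_power: "x \<in> \<O> \<Longrightarrow> \<pi> x [^]\<^bsub>R\<^esub> (m::nat) = \<pi> (x ^ m)"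
proof -
  interpret h: ring_hom_cring "val_ring v" R \<pi> by (rule pi_ring_hom_cring)
  show add: "x \<in> \<O> \<Longrightarrow> y \<in> \<O> \<Longrightarrow> \<pi> x \<oplus>\<^bsub>R\<^esub> \<pi> y = \<pi> (x + y)" for x y
    using h.hom_add by simp
  show mult: "x \<in> \<O> \<Longrightarrow> y \<in> \<O> \<Longrightarrow> \<pi> x \<otimes>\<^bsub>R\<^esub> \<pi> y = \<pi> (x * y)" for x y
    using h.hom_mult by simp
  show one: "\<one>\<^bsub>R\<^esub> = \<pi> 1" using h.hom_one by simp
  show zero: "\<zero>\<^bsub>R\<^esub> = \<pi> 0" using h.hom_zero by simp
  show "x \<in> \<O> \<Longrightarrow> \<ominus>\<^bsub>R\<^esub> \<pi> x = \<pi> (- x)"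
  proof -
    assume x: "x \<in> \<O>"
    then have "\<pi> (- x) \<oplus>\<^bsub>R\<^esub> \<pi> x = \<zero>\<^bsub>R\<^esub>" using add[of "- x" x] zero by simp
    from h.S.minus_equality[OF this] show ?thesis using x h.hom_closed by simp
  qed
  show "x \<in> \<O> \<Longrightarrow> \<pi> x [^]\<^bsub>R\<^esub> m = \<pi> (x ^ m)"
    by (induction m) (simp_all only: nat_pow_0 nat_pow_Suc one mult O_closed power_0 power_Suc2)
qed

lemma frobenius_surj:
  assumes "a \<in> \<O>"
  obtains b where "b \<in> \<O>" "pcong 1 a (b ^ p)"
proof -
  have "\<pi> a \<in> (\<lambda>x. x [^]\<^bsub>R\<^esub> p) ` carrier R"
    using ramified assms unfolding roughly_deeply_ramified_def by (auto simp: carrier_R)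
  then obtain b where "b \<in> \<O>" "\<pi> a = \<pi> (b ^ p)" by (auto simp: carrier_R pi_power)
  then show ?thesis using that assms pi_eq_iff by auto
qed

lemma frobenius_surj_iter:
  assumes "a \<in> \<O>"
  shows "\<exists>b\<in>\<O>. pcong 1 a (b ^ p ^ k)"
proof (induction k)
  case 0
  show ?case using assms by (auto intro: bexI[of _ a])
next
  case (Suc k)
  then obtain b where b: "b \<in> \<O>" "pcong 1 a (b ^ p ^ k)" by blast
  obtain c where c: "c \<in> \<O>" "pcong 1 b (c ^ p)" using frobenius_surj[OF b(1)] .
  have "pcong (Suc k) (b ^ p ^ k) ((c ^ p) ^ p ^ k)" by (rule pcong_power) (use c in auto)
  then have "pcong 1 (b ^ p ^ k) (c ^ p ^ Suc k)"
    using pcong_le[of "Suc k" _ _ 1] by (simp add: power_mult)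
  then show ?case using b c pcong_trans by blast
qed

section \<open>Roots of p\<close>

lemma v_mult: "x \<noteq> 0 \<Longrightarrow> y \<noteq> 0 \<Longrightarrow> v (x * y) = v x + v y"
  using val by (simp add: valuation_def)

lemma v_inverse: "x \<noteq> 0 \<Longrightarrow> v (inverse x) = - v x"
  using v_mult[of x "inverse x"] valuation_one[OF val] by (simp add: eq_neg_iff_add_eq_0 add.commute)

lemma v_divide: "x \<noteq> 0 \<Longrightarrow> y \<noteq> 0 \<Longrightarrow> v (x / y) = v x - v y"
  using v_mult[of x "inverse y"] by (simp add: v_inverse divide_inverse)

lemma integrally_closed:
  assumes "x ^ m \<in> \<O>" "m > 0"
  shows "x \<in> \<O>"
proof (rule ccontr)
  assume x: "x \<notin> \<O>"
  then have "x \<noteq> 0" "inverse x \<in> \<O>" by (auto simp: O_iff v_inverse)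
  then have "x ^ m * inverse x ^ (m - 1) \<in> \<O>" using assms by auto
  also have "x ^ m * inverse x ^ (m - 1) = x"
    using \<open>x \<noteq> 0\<close> \<open>m > 0\<close> by (cases m) (simp_all flip: power_mult_distrib)
  finally show False using x by simp
qed

definition unit :: "'k \<Rightarrow> bool" where
  "unit u \<longleftrightarrow> u \<noteq> 0 \<and> u \<in> \<O> \<and> inverse u \<in> \<O>"

lemma unit_mult: "unit u \<Longrightarrow> unit w \<Longrightarrow> unit (u * w)"
  and unit_power: "unit u \<Longrightarrow> unit (u ^ m)"
  by (auto simp: unit_def power_inverse[symmetric])

lemma unit_one_plus:
  assumes m: "m = 0 \<or> 0 < v m"
  shows "unit (1 + m)"
proof -
  define w where "w = 1 + m"
  have "m \<in> \<O>" using m by (auto simp: O_iff)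
  then have w: "w \<in> \<O>" by (simp add: w_def)
  have "\<not> (w = 0 \<or> 0 < v w)"
  proof
    assume w': "w = 0 \<or> 0 < v w"
    have eq: "1 = w + (- m)" by (simp add: w_def)
    show False
    proof (cases "w = 0 \<or> m = 0")
      case True
      then show False using w' m eq valuation_one[OF val] valuation_minus[OF val, of m] by auto
    next
      case False
      then have "min (v w) (v (- m)) \<le> v 1"
        using val eq unfolding valuation_def by (metis neg_equal_0_iff_equal zero_neq_one)
      then show False
        using False w' m by (auto simp: valuation_minus[OF val] valuation_one[OF val] min_le_iff_disj)
    qed
  qed
  then have "w \<noteq> 0" "v w = 0" using w by (auto simp: O_iff)
  then show ?thesis unfolding w_def[symmetric] by (auto simp: unit_def O_iff v_inverse)
qed

text \<open>
  A representative \<open>y ^ p\<close> of the class of \<open>x\<close> modulo \<open>p\<close> differs from \<open>x\<close> by something of larger value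
  than \<open>x\<close>, provided that \<open>v x < v p\<close>; the hypothesis \<open>x / P \<notin> \<O>\<close> says just that.
\<close>

lemma root_up_to_unit:
  assumes x: "x \<in> \<O>" "x / P \<notin> \<O>"
  obtains y u where "y \<in> \<O>" "unit u" "y ^ p = x * u"
proof -
  have x0: "x \<noteq> 0" using x(2) by auto
  obtain y where y: "y \<in> \<O>" "pcong 1 x (y ^ p)" using frobenius_surj[OF x(1)] .
  from pcong_sym[OF y(2)] obtain c where c: "c \<in> \<O>" "y ^ p = x + P * c"
    by (auto simp: pcong_def)
  have "v x < v P" using x(2) x0 p_nonzero by (auto simp: O_iff v_divide)
  have "P / x * c = 0 \<or> 0 < v (P / x * c)"
  proof (cases "c = 0")
    case False
    then have "0 \<le> v c" using c by (simp add: O_iff)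
    have "v (P / x * c) = (v P - v x) + v c"
      using False x0 p_nonzero by (simp add: v_mult v_divide del: times_divide_eq_left)
    then show ?thesis using \<open>v x < v P\<close> \<open>0 \<le> v c\<close> by (simp add: add_pos_nonneg)
  qed simp
  from unit_one_plus[OF this] show ?thesis
    using that[of y "1 + P / x * c"] y c x0 by (simp add: field_simps)
qed

text \<open>
  As \<open>v p\<close> is not the smallest positive value, \<open>p\<close> is a product of two elements of smaller positive
  value, and both are \<open>p\<close>-th powers up to units.  So \<open>p\<close> is a \<open>p\<close>-th power up to a unit; the root
  has value less than \<open>v p\<close>, so that it can be replaced by a \<open>p\<close>-th power again, and so on.
\<close>

lemma root_of_p:
  "\<exists>w u. w \<in> \<O> \<and> unit u \<and> w ^ p ^ k = P * u"
proof (cases "inverse P \<in> \<O>")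
  case True
  then show ?thesis using p_nonzero
    by (intro exI[of _ 1] exI[of _ "inverse P"]) (auto simp: unit_def)
next
  case False
  have vP: "0 < v P" using False p_nonzero by (simp add: O_iff v_inverse)
  have first: "\<exists>w u. w \<in> \<O> \<and> unit u \<and> w ^ p = P * u"
  proof -
    have "v P \<in> value_group v" using p_nonzero by (auto simp: value_group_def)
    then obtain a where a: "a \<noteq> 0" "0 < v a" "v a < v P"
      using ramified vP unfolding roughly_deeply_ramified_def smallest_positive_value_def
      by (auto simp: value_group_def not_le)
    have "a \<in> \<O>" "a / P \<notin> \<O>" "P / a \<in> \<O>" "P / a / P \<notin> \<O>"
      using a p_nonzero by (auto simp: O_iff v_divide v_inverse valuation_one[OF val])
    then obtain y1 u1 y2 u2 where "y1 \<in> \<O>" "unit u1" "y1 ^ p = a * u1"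
      "y2 \<in> \<O>" "unit u2" "y2 ^ p = P / a * u2" by (meson root_up_to_unit)
    then show ?thesis using a
      by (intro exI[of _ "y1 * y2"] exI[of _ "u1 * u2"]) (auto simp: unit_mult power_mult_distrib)
  qed
  show ?thesis
  proof (induction k)
    case 0
    show ?case by (intro exI[of _ P] exI[of _ 1]) (auto simp: unit_def)
  next
    case (Suc k)
    show ?case
    proof (cases "k = 0")
      case True
      then show ?thesis using first by simp
    next
      case k: False
      obtain w u where w: "w \<in> \<O>" "unit u" "w ^ p ^ k = P * u" using Suc by blast
      \<comment> \<open>otherwise a proper power of p would divide p times a unit\<close>
      have "w / P \<notin> \<O>"
      proof
        assume c: "w / P \<in> \<O>"
        have "p ^ k = Suc (Suc (p ^ k - 2))"
          using k prime_gt_1_nat[OF prime] one_less_power[of p k] by simp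
        then obtain j where j: "p ^ k = Suc (Suc j)" by blast
        define d where "d = P ^ j * (w / P) ^ p ^ k"
        have "P * u = P ^ p ^ k * (w / P) ^ p ^ k"
          unfolding w(3)[symmetric] power_mult_distrib[symmetric] using p_nonzero by simp
        also have "\<dots> = P * (P * d)" by (simp add: d_def j)
        finally have "u = P * d" using p_nonzero by simp
        then have "inverse P = d * inverse u" using w(2) by (auto simp: unit_def)
        also have "\<dots> \<in> \<O>" using c w by (auto simp: unit_def d_def)
        finally show False using False by simp
      qed
      then obtain y u' where y: "y \<in> \<O>" "unit u'" "y ^ p = w * u'"
        using root_up_to_unit[OF w(1)] by blast
      have "y ^ p ^ Suc k = P * (u * u' ^ p ^ k)"
        using w y by (simp add: power_mult power_mult_distrib)
      then show ?thesis using w y unit_mult unit_power by blast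
    qed
  qed
qed

section \<open>Ghost components of polynomial functions\<close>

text \<open>
  The formula for \<open>\<omega>\<^sub>n\<close> on representatives.  In contrast to \<^const>\<open>witt_poly\<close>, \<open>n\<close> is the number of
  variables, so that inductions can start at \<open>n = 0\<close>, where all elements of \<open>\<O>\<close> are congruent.
\<close>

definition ghost :: "nat \<Rightarrow> (nat \<Rightarrow> 'k) \<Rightarrow> 'k" where
  "ghost n x = (\<Sum>i<n. P ^ i * x i ^ p ^ (n - 1 - i))"

lemma ghost_0 [simp]: "ghost 0 x = 0"
  by (simp add: ghost_def)

lemma ghost_Suc: "ghost (Suc n) x = x 0 ^ p ^ n + P * ghost n (\<lambda>i. x (Suc i))"
  unfolding ghost_def sum.lessThan_Suc_shift
  by (simp add: sum_distrib_left mult.assoc Suc_diff_Suc)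

lemma ghost_cong: "(\<And>i. i < n \<Longrightarrow> x i = y i) \<Longrightarrow> ghost n x = ghost n y"
  by (simp add: ghost_def)

lemma ghost_in_O: "(\<And>i. i < n \<Longrightarrow> x i \<in> \<O>) \<Longrightarrow> ghost n x \<in> \<O>"
  by (auto simp: ghost_def)

lemma witt_poly_eq_ghost: "n \<ge> 1 \<Longrightarrow> witt_poly p (n - 1) x = ghost n x"
  by (auto simp: witt_poly_def ghost_def intro!: sum.cong)

lemma ghost_single:
  assumes "k < n"
  shows "ghost n (\<lambda>i. if i = k then m else 0) = P ^ k * m ^ p ^ (n - 1 - k)"
proof -
  have "ghost n (\<lambda>i. if i = k then m else 0)
      = (\<Sum>i<n. if i = k then P ^ k * m ^ p ^ (n - 1 - k) else 0)"
    unfolding ghost_def using prime_gt_0_nat[OF prime] by (intro sum.cong) (auto simp: power_0_left)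
  then show ?thesis using assms by simp
qed

text \<open>
  The Teichmueller representative of \<open>m ^ p\<close>, whose image under \<open>\<omega>\<^sub>n\<close> is \<open>m ^ p ^ n\<close>, multiplies Witt
  vectors coordinatewise.
\<close>

lemma ghost_scale:
  "ghost n (\<lambda>i. x i * m ^ p ^ Suc i) = m ^ p ^ n * ghost n x"
proof -
  have "m ^ p ^ n = (m ^ p ^ Suc i) ^ p ^ (n - 1 - i)" if "i < n" for i
    using that by (simp flip: power_mult power_add power_Suc)
  then show ?thesis
    unfolding ghost_def sum_distrib_left
    by (intro sum.cong) (auto simp: power_mult_distrib)
qed

text \<open>
  The coordinates are found one at a time: modulo \<open>p\<close> the element is a \<open>p\<^sup>n\<close>-th power, and the remainder
  is \<open>p\<close> times an element to be treated at the next lower level.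
\<close>

lemma ghost_surj:
  "a \<in> \<O> \<Longrightarrow> \<exists>x. (\<forall>i. x i \<in> \<O>) \<and> pcong n a (ghost n x)"
proof (induction n arbitrary: a)
  case 0
  then show ?case by (intro exI[of _ "\<lambda>_. 0"]) (simp add: pcong_0)
next
  case (Suc n)
  obtain b where b: "b \<in> \<O>" "pcong 1 a (b ^ p ^ n)" using frobenius_surj_iter[OF Suc.prems] by blast
  then obtain c where c: "c \<in> \<O>" "a = b ^ p ^ n + P * c" by (auto simp: pcong_def)
  obtain x where x: "\<forall>i. x i \<in> \<O>" "pcong n c (ghost n x)" using Suc.IH[OF c(1)] by blast
  have "pcong (Suc n) a (ghost (Suc n) (case_nat b x))"
    by (simp add: c(2) ghost_Suc pcong_add_left_iff pcong_Suc_iff x(2))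
  then show ?case using b x by (intro exI[of _ "case_nat b x"]) (auto split: nat.split)
qed

text \<open>
  These are the lifts to representatives of the functions given by \<^const>\<open>L_ring\<close>-terms with constants
  from \<open>\<O>/(p)\<close>; using functions instead of terms keeps the arithmetic free of syntax.
\<close>

inductive_set poly_funs :: "nat set \<Rightarrow> ((nat \<Rightarrow> 'k) \<Rightarrow> 'k) set" for V where
  var: "i \<in> V \<Longrightarrow> (\<lambda>e. e i) \<in> poly_funs V"
| const: "c \<in> \<O> \<Longrightarrow> (\<lambda>e. c) \<in> poly_funs V"
| add: "f \<in> poly_funs V \<Longrightarrow> g \<in> poly_funs V \<Longrightarrow> (\<lambda>e. f e + g e) \<in> poly_funs V"
| mult: "f \<in> poly_funs V \<Longrightarrow> g \<in> poly_funs V \<Longrightarrow> (\<lambda>e. f e * g e) \<in> poly_funs V"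

lemma poly_power: "f \<in> poly_funs V \<Longrightarrow> (\<lambda>e. f e ^ m) \<in> poly_funs V"
  by (induction m) (auto intro: poly_funs.const poly_funs.mult)

lemma poly_mono: "f \<in> poly_funs V \<Longrightarrow> V \<subseteq> W \<Longrightarrow> f \<in> poly_funs W"
  by (induction rule: poly_funs.induct) (auto intro: poly_funs.intros)

lemma poly_in_O: "f \<in> poly_funs V \<Longrightarrow> (\<forall>i\<in>V. e i \<in> \<O>) \<Longrightarrow> f e \<in> \<O>"
  by (induction rule: poly_funs.induct) auto

lemma poly_fun_upd: "f \<in> poly_funs V \<Longrightarrow> i \<notin> V \<Longrightarrow> f (e(i := a)) = f e"
  by (induction rule: poly_funs.induct) auto

text \<open>
  For representable \<open>F\<close> and \<open>G\<close>, the congruence of \<open>F e\<close> and \<open>G e\<close> modulo \<open>p\<^sup>n\<close> is an instance of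
  \<open>ker\<^sub>n\<close> with polynomial arguments.
\<close>

definition representable :: "nat \<Rightarrow> nat set \<Rightarrow> ((nat \<Rightarrow> 'k) \<Rightarrow> 'k) \<Rightarrow> bool" where
  "representable n V F \<longleftrightarrow> (\<exists>x. (\<forall>i<n. x i \<in> poly_funs V) \<and>
     (\<forall>e. (\<forall>i\<in>V. e i \<in> \<O>) \<longrightarrow> pcong n (F e) (ghost n (\<lambda>i. x i e))))"

lemma representableI:
  assumes "\<And>i. i < n \<Longrightarrow> x i \<in> poly_funs V"
    and "\<And>e. \<forall>i\<in>V. e i \<in> \<O> \<Longrightarrow> pcong n (F e) (ghost n (\<lambda>i. x i e))"
  shows "representable n V F"
  using assms unfolding representable_def by blast

lemma representable_pcong:
  assumes "representable n V F" "\<And>e. \<forall>i\<in>V. e i \<in> \<O> \<Longrightarrow> pcong n (G e) (F e)"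
  shows "representable n V G"
  using assms unfolding representable_def by (meson pcong_trans)

lemma representable_ghost:
  "(\<And>i. i < n \<Longrightarrow> x i \<in> poly_funs V) \<Longrightarrow> representable n V (\<lambda>e. ghost n (\<lambda>i. x i e))"
  by (rule representableI[of n x]) auto

lemma representable_zero: "representable n V (\<lambda>e. 0)"
  by (rule representable_pcong[OF representable_ghost[of n "\<lambda>_ _. 0"]])
     (use prime_gt_0_nat[OF prime] in \<open>auto simp: ghost_def power_0_left intro: poly_funs.const\<close>)

lemma representable_single:
  assumes "m \<in> poly_funs V" "k < n"
  shows "representable n V (\<lambda>e. P ^ (n - 1 - k) * m e ^ p ^ k)"
proof (rule representable_pcong[OF representable_ghost])
  let ?x = "\<lambda>i e. if i = n - 1 - k then m e else 0"
  show "?x i \<in> poly_funs V" for i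
    using assms(1) by (cases "i = n - 1 - k") (auto intro: poly_funs.const)
  show "pcong n (P ^ (n - 1 - k) * m e ^ p ^ k) (ghost n (\<lambda>i. ?x i e))" for e
    using assms(2) by (simp add: ghost_single)
qed

text \<open>
  Closure under addition is an assumption here and in the two other lemmas that carry it, because they
  serve inside the inductive proof of that closure: addition at level \<open>n + 1\<close> needs sums and carries at
  level \<open>n\<close>.
\<close>

lemma representable_sum:
  assumes "finite A" "\<And>j. j \<in> A \<Longrightarrow> representable n V (F j)"
    and add: "\<And>F G. representable n V F \<Longrightarrow> representable n V G \<Longrightarrow> representable n V (\<lambda>e. F e + G e)"
  shows "representable n V (\<lambda>e. \<Sum>j\<in>A. F j e)"
  using assms(1,2) by (induction A rule: finite_induct) (auto intro: add representable_zero)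

lemma representable_of_nat_mult:
  assumes "representable n V F"
    and add: "\<And>F G. representable n V F \<Longrightarrow> representable n V G \<Longrightarrow> representable n V (\<lambda>e. F e + G e)"
  shows "representable n V (\<lambda>e. of_nat c * F e)"
  using representable_sum[of "{..<c}" n V "\<lambda>_. F"] assms by simp

text \<open>
  This is \<open>((a + b) ^ q - a ^ q - b ^ q) / p\<close> for \<open>q = p\<^sup>n\<close>, written without division in the field
  so that it visibly has integral coefficients.
\<close>

definition carry :: "nat \<Rightarrow> 'k \<Rightarrow> 'k \<Rightarrow> 'k" where
  "carry n a b = (\<Sum>j\<in>{0<..<p ^ n}. of_nat ((p ^ n choose j) div p) * (a ^ j * b ^ (p ^ n - j)))"

lemma carry_in_O: "a \<in> \<O> \<Longrightarrow> b \<in> \<O> \<Longrightarrow> carry n a b \<in> \<O>"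
  unfolding carry_def by auto

text \<open>
  Kummer's estimate, with \<open>k\<close> the exponent of \<open>p\<close> in \<open>j\<close>; it follows from
  \<open>j * (q choose j) = q * ((q - 1) choose (j - 1))\<close>.
\<close>

lemma prime_power_dvd_choose:
  assumes "0 < j" "j < p ^ n"
  shows "\<exists>k<n. p ^ k dvd j \<and> p ^ (n - k) dvd (p ^ n choose j)"
proof -
  obtain k m where j: "j = p ^ k * m" "\<not> p dvd m"
    using assms(1) prime by (metis dvd_refl gr_implies_not0 multiplicity_decompose' not_prime_unit)
  have "m > 0" using j assms(1) by (cases m) auto
  then have "p ^ k \<le> j" by (simp add: j(1))
  then have "p ^ k < p ^ n" using assms(2) by simp
  then have k: "k < n" using prime_gt_1_nat[OF prime] power_less_imp_less_exp by blast
  have "p ^ k * (m * (p ^ n choose j)) = p ^ n * ((p ^ n - 1) choose (j - 1))"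
    using times_binomial_minus1_eq[OF assms(1), of "p ^ n"] by (simp add: j(1) mult.assoc)
  also have "\<dots> = p ^ k * (p ^ (n - k) * ((p ^ n - 1) choose (j - 1)))"
    using k by (simp flip: power_add mult.assoc)
  finally have "p ^ (n - k) dvd m * (p ^ n choose j)"
    using prime_gt_0_nat[OF prime] by auto
  moreover have "coprime (p ^ (n - k)) m"
    using j(2) prime by (simp add: prime_imp_coprime)
  ultimately have "p ^ (n - k) dvd (p ^ n choose j)" by (simp add: coprime_dvd_mult_right_iff)
  then show ?thesis using k j by auto
qed

lemma power_add_carry:
  "(a + b) ^ p ^ n = a ^ p ^ n + b ^ p ^ n + P * carry n a b"
proof -
  let ?q = "p ^ n"
  have q: "?q > 0" using prime_gt_0_nat[OF prime] by simp
  have div: "of_nat (?q choose j) = P * of_nat ((?q choose j) div p)" if j: "j \<in> {0<..<?q}" for j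
  proof -
    obtain k where "k < n" "p ^ (n - k) dvd (?q choose j)"
      using prime_power_dvd_choose[of j n] j by auto
    then have "p dvd (?q choose j)" by (metis dvd_power dvd_trans zero_less_diff)
    then show ?thesis by (metis dvd_mult_div_cancel of_nat_mult)
  qed
  have "(a + b) ^ ?q = (\<Sum>j\<le>?q. of_nat (?q choose j) * a ^ j * b ^ (?q - j))"
    by (rule binomial_ring)
  also have "{..?q} = insert 0 (insert ?q {0<..<?q})" by auto
  also have "(\<Sum>j\<in>insert 0 (insert ?q {0<..<?q}). of_nat (?q choose j) * a ^ j * b ^ (?q - j))
      = a ^ ?q + b ^ ?q + (\<Sum>j\<in>{0<..<?q}. of_nat (?q choose j) * a ^ j * b ^ (?q - j))"
    using q by (simp add: algebra_simps)
  also have "(\<Sum>j\<in>{0<..<?q}. of_nat (?q choose j) * a ^ j * b ^ (?q - j)) = P * carry n a b"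
    unfolding carry_def sum_distrib_left
    by (rule sum.cong) (simp_all only: div mult.assoc)
  finally show ?thesis .
qed

text \<open>
  If \<open>k\<close> is the exponent of \<open>p\<close> in \<open>j\<close>, then the term of index \<open>j\<close> is an integer multiple of
  \<open>p ^ (n - 1 - k) * m ^ p ^ k\<close> for a monomial \<open>m\<close>: the image of a Witt vector with the single
  coordinate \<open>m\<close> at place \<open>n - 1 - k\<close>.
\<close>

lemma representable_carry_aux:
  assumes f: "f \<in> poly_funs V" and g: "g \<in> poly_funs V"
    and add: "\<And>F G. representable n V F \<Longrightarrow> representable n V G \<Longrightarrow> representable n V (\<lambda>e. F e + G e)"
  shows "representable n V (\<lambda>e. carry n (f e) (g e))"
  unfolding carry_def
proof (rule representable_sum[OF _ _ add])
  fix j assume j: "j \<in> {0<..<p ^ n}"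
  then obtain k where k: "k < n" "p ^ k dvd j" "p ^ (n - k) dvd (p ^ n choose j)"
    using prime_power_dvd_choose[of j n] by auto
  obtain c where c: "p ^ n choose j = p ^ (n - k) * c" using k(3) by blast
  have "p ^ (n - k) = p * p ^ (n - 1 - k)"
    using k(1) by (simp flip: power_Suc add: Suc_diff_Suc)
  then have c': "(p ^ n choose j) div p = c * p ^ (n - 1 - k)"
    using c prime_gt_0_nat[OF prime] by simp
  have "p ^ k dvd p ^ n" using k(1) by (simp add: le_imp_power_dvd)
  then have "p ^ k dvd p ^ n - j" using k(2) by (rule dvd_diff_nat)
  then obtain s t where st: "j = s * p ^ k" "p ^ n - j = t * p ^ k" using k(2) by (metis dvdE mult.commute)
  define m where "m e = f e ^ s * g e ^ t" for e
  have "m \<in> poly_funs V" unfolding m_def[abs_def] by (intro poly_funs.mult poly_power f g)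
  then have "representable n V (\<lambda>e. of_nat c * (P ^ (n - 1 - k) * m e ^ p ^ k))"
    using k(1) by (intro representable_of_nat_mult[OF _ add] representable_single)
  also have "(\<lambda>e. of_nat c * (P ^ (n - 1 - k) * m e ^ p ^ k))
      = (\<lambda>e. of_nat ((p ^ n choose j) div p) * (f e ^ j * g e ^ (p ^ n - j)))"
    unfolding c' st(2) power_mult m_def power_mult_distrib
    by (subst st(1)) (simp add: power_mult mult.assoc)
  finally show "representable n V
      (\<lambda>e. of_nat ((p ^ n choose j) div p) * (f e ^ j * g e ^ (p ^ n - j)))" .
qed simp

text \<open>
  Induction on \<open>n\<close>: adding \<open>x\<^sub>0 ^ q + p X\<close> and \<open>y\<^sub>0 ^ q + p Y\<close> gives
  \<open>(x\<^sub>0 + y\<^sub>0) ^ q + p (X + Y - carry(x\<^sub>0, y\<^sub>0))\<close>, so that the first coordinate is \<open>x\<^sub>0 + y\<^sub>0\<close> and the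
  others come from level \<open>n\<close>.
\<close>

lemma representable_add:
  "representable n V F \<Longrightarrow> representable n V G \<Longrightarrow> representable n V (\<lambda>e. F e + G e)"
proof (induction n arbitrary: F G)
  case 0
  then obtain x y where "\<And>e. \<forall>i\<in>V. e i \<in> \<O> \<Longrightarrow> pcong 0 (F e) 0" "\<And>e. \<forall>i\<in>V. e i \<in> \<O> \<Longrightarrow> pcong 0 (G e) 0"
    by (auto simp: representable_def)
  then show ?case using pcong_add[of 0 _ 0 _ 0] by (intro representableI[of 0]) auto
next
  case (Suc n)
  obtain x where x: "\<And>i. i < Suc n \<Longrightarrow> x i \<in> poly_funs V"
    "\<And>e. \<forall>i\<in>V. e i \<in> \<O> \<Longrightarrow> pcong (Suc n) (F e) (ghost (Suc n) (\<lambda>i. x i e))"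
    using Suc.prems(1) unfolding representable_def by blast
  obtain y where y: "\<And>i. i < Suc n \<Longrightarrow> y i \<in> poly_funs V"
    "\<And>e. \<forall>i\<in>V. e i \<in> \<O> \<Longrightarrow> pcong (Suc n) (G e) (ghost (Suc n) (\<lambda>i. y i e))"
    using Suc.prems(2) unfolding representable_def by blast
  define X where "X e = ghost n (\<lambda>i. x (Suc i) e)" for e
  define Y where "Y e = ghost n (\<lambda>i. y (Suc i) e)" for e
  define D where "D e = carry n (x 0 e) (y 0 e)" for e
  have "representable n V X" "representable n V Y"
    unfolding X_def[abs_def] Y_def[abs_def] using x(1) y(1) by (auto intro!: representable_ghost)
  moreover have "representable n V D"
    unfolding D_def[abs_def] using x(1) y(1) by (intro representable_carry_aux Suc.IH) auto
  \<comment> \<open>multiplication by p^n - 1 is negation modulo p^n\<close>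
  ultimately have "representable n V (\<lambda>e. (X e + Y e) + of_nat (p ^ n - 1) * D e)"
    by (intro Suc.IH representable_of_nat_mult[OF _ Suc.IH])
  then obtain z where z: "\<And>i. i < n \<Longrightarrow> z i \<in> poly_funs V"
    "\<And>e. \<forall>i\<in>V. e i \<in> \<O> \<Longrightarrow> pcong n ((X e + Y e) + of_nat (p ^ n - 1) * D e) (ghost n (\<lambda>i. z i e))"
    unfolding representable_def by blast
  show ?case
  proof (rule representableI)
    let ?z = "case_nat (\<lambda>e. x 0 e + y 0 e) z"
    show "?z i \<in> poly_funs V" if "i < Suc n" for i
      using that x(1)[of 0] y(1)[of 0] z(1) by (auto split: nat.split intro: poly_funs.add)
    fix e :: "nat \<Rightarrow> 'k" assume e: "\<forall>i\<in>V. e i \<in> \<O>"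
    have xy: "x 0 e \<in> \<O>" "y 0 e \<in> \<O>" using x(1) y(1) e by (auto intro: poly_in_O)
    have "of_nat (p ^ n - 1) * D e = P ^ n * D e - D e"
      using prime_gt_0_nat[OF prime] by (simp add: of_nat_diff algebra_simps)
    then have "pcong n (X e + Y e - D e) ((X e + Y e) + of_nat (p ^ n - 1) * D e)"
      unfolding pcong_def using carry_in_O[OF xy]
      by (intro bexI[of _ "- D e"]) (auto simp: D_def)
    from pcong_trans[OF this z(2)[OF e]]
    have "pcong (Suc n) ((x 0 e + y 0 e) ^ p ^ n + P * (X e + Y e - D e))
        (ghost (Suc n) (\<lambda>i. ?z i e))"
      by (simp add: ghost_Suc pcong_add_left_iff pcong_Suc_iff)
    also have "(x 0 e + y 0 e) ^ p ^ n + P * (X e + Y e - D e)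
        = ghost (Suc n) (\<lambda>i. x i e) + ghost (Suc n) (\<lambda>i. y i e)"
      by (simp add: ghost_Suc power_add_carry D_def X_def Y_def algebra_simps)
    finally show "pcong (Suc n) (F e + G e) (ghost (Suc n) (\<lambda>i. ?z i e))"
      using pcong_trans[OF pcong_add[OF x(2)[OF e] y(2)[OF e]]] by blast
  qed
qed

lemma representable_carry:
  "f \<in> poly_funs V \<Longrightarrow> g \<in> poly_funs V \<Longrightarrow> representable n V (\<lambda>e. carry n (f e) (g e))"
  by (rule representable_carry_aux[OF _ _ representable_add])

lemma representable_const_mult_power:
  assumes "c \<in> \<O>" "f \<in> poly_funs V"
  shows "representable n V (\<lambda>e. c * f e ^ p ^ n)"
proof -
  obtain w where w: "\<forall>i. w i \<in> \<O>" "pcong n c (ghost n w)" using ghost_surj[OF assms(1)] by blast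
  show ?thesis
  proof (rule representableI)
    show "(\<lambda>e. w i * f e ^ p ^ Suc i) \<in> poly_funs V" for i
      using w assms by (intro poly_funs.mult poly_power poly_funs.const) auto
    show "pcong n (c * f e ^ p ^ n) (ghost n (\<lambda>i. w i * f e ^ p ^ Suc i))"
      if "\<forall>i\<in>V. e i \<in> \<O>" for e
      unfolding ghost_scale using pcong_mult_left[OF _ w(2), of "f e ^ p ^ n"] poly_in_O[OF assms(2) that]
      by (simp add: mult.commute)
  qed
qed

section \<open>The kernel of the ghost map\<close>

text \<open>
  As \<open>w ^ q\<close> is \<open>p\<close> up to a unit, \<open>(a / w) ^ q\<close> is integral, hence so is \<open>a / w\<close>.
\<close>

lemma root_dvd:
  assumes w: "unit u" "w ^ p ^ n = P * u" and a: "a \<in> \<O>" "pcong 1 (a ^ p ^ n) 0"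
  shows "\<exists>z\<in>\<O>. a = w * z"
proof -
  obtain c where c: "c \<in> \<O>" "a ^ p ^ n = P * c" using a(2) by (auto simp: pcong_def)
  have w0: "w \<noteq> 0" using w p_nonzero prime_gt_0_nat[OF prime] by (auto simp: unit_def power_0_left)
  have "(a / w) ^ p ^ n = c * inverse u"
    using c w p_nonzero by (simp add: power_divide unit_def divide_simps)
  then have "a / w \<in> \<O>"
    using integrally_closed[of "a / w" "p ^ n"] c w prime_gt_0_nat[OF prime] by (auto simp: unit_def)
  then show ?thesis using w0 by (intro bexI[of _ "a / w"]) auto
qed

text \<open>
  Modulo \<open>p\<close>, raising to the power \<open>p\<^sup>n\<close> is additive.
\<close>

lemma frobenius_iter_sub:
  assumes "a \<in> \<O>" "b \<in> \<O>" "pcong 1 (a ^ p ^ n) (b ^ p ^ n)"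
  shows "pcong 1 ((a - b) ^ p ^ n) 0"
proof -
  have "a ^ p ^ n = (a - b) ^ p ^ n + b ^ p ^ n + P * carry n (a - b) b"
    using power_add_carry[of "a - b" b n] by simp
  moreover have "carry n (a - b) b \<in> \<O>" using assms by (simp add: carry_in_O)
  ultimately have "pcong 1 (a ^ p ^ n) (b ^ p ^ n + (a - b) ^ p ^ n)"
    unfolding pcong_def by (intro bexI) auto
  then have "pcong 1 (b ^ p ^ n + (a - b) ^ p ^ n) (b ^ p ^ n + 0)"
    using assms(3) by (metis add.right_neutral pcong_sym pcong_trans)
  then show ?thesis by (simp only: pcong_add_left_iff)
qed

text \<open>
  The recursion on which the definition of the kernels rests.  The element \<open>z\<close> ranges over \<open>\<O>\<close>, but
  both conditions depend on its class modulo \<open>p\<close> only, so that the quantifier is one over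
  \<open>\<O>/(p)\<close>.
\<close>

lemma ghost_pcong_Suc_iff:
  assumes w: "w \<in> \<O>" "unit u" "w ^ p ^ n = P * u"
    and a: "a \<in> \<O>" and b: "b \<in> \<O>" and X: "X \<in> \<O>" and Y: "Y \<in> \<O>"
  shows "pcong (Suc n) (a ^ p ^ n + P * X) (b ^ p ^ n + P * Y) \<longleftrightarrow>
    (\<exists>z\<in>\<O>. pcong 1 a (b + w * z) \<and> pcong n (u * z ^ p ^ n + X + carry n b (w * z)) Y)"
proof -
  have step: "pcong (Suc n) (a ^ p ^ n + P * X) (b ^ p ^ n + P * Y) \<longleftrightarrow>
      pcong n (u * z ^ p ^ n + X + carry n b (w * z)) Y"
    if z: "z \<in> \<O>" "pcong 1 a (b + w * z)" for z
  proof -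
    have "pcong (Suc n) (a ^ p ^ n) ((b + w * z) ^ p ^ n)"
      using z b w by (intro pcong_power) auto
    then have "pcong (Suc n) (a ^ p ^ n + P * X) ((b + w * z) ^ p ^ n + P * X)"
      by (intro pcong_add) auto
    also have "(b + w * z) ^ p ^ n + P * X
        = b ^ p ^ n + P * (u * z ^ p ^ n + X + carry n b (w * z))"
      unfolding power_add_carry power_mult_distrib w(3) by (simp add: algebra_simps)
    finally have "pcong (Suc n) (a ^ p ^ n + P * X) (b ^ p ^ n + P * Y) \<longleftrightarrow>
        pcong (Suc n) (b ^ p ^ n + P * (u * z ^ p ^ n + X + carry n b (w * z))) (b ^ p ^ n + P * Y)"
      by (rule pcong_trans_iff) simp
    then show ?thesis by (simp only: pcong_add_left_iff pcong_Suc_iff)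
  qed
  have "\<exists>z\<in>\<O>. pcong 1 a (b + w * z)"
    if eq: "pcong (Suc n) (a ^ p ^ n + P * X) (b ^ p ^ n + P * Y)"
  proof -
    have drop: "pcong 1 (c + P * d) c" if "d \<in> \<O>" for c d
      using that by (auto simp: pcong_def)
    have "pcong 1 (a ^ p ^ n) (b ^ p ^ n)"
      using pcong_le[OF eq, of 1] pcong_trans_iff[OF drop[OF X] drop[OF Y]] by simp
    then obtain z where "z \<in> \<O>" "a - b = w * z"
      using root_dvd[OF w(2,3)] frobenius_iter_sub[OF a b] a b by (meson O_diff)
    then show ?thesis by (intro bexI[of _ z]) (auto simp: algebra_simps)
  qed
  then show ?thesis using step by blast
qed

section \<open>Definability of the kernels\<close>

abbreviation "L_R \<equiv> with_consts L_ring (carrier R)"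
abbreviation "M_R \<equiv> expand (ring_structure R)"

text \<open>
  The logic speaks about classes and the arithmetic about representatives; \<open>e\<close> chooses representatives
  of the values of \<open>\<epsilon>\<close> for the variables in \<open>V\<close>.
\<close>

definition lifts :: "nat set \<Rightarrow> (nat \<Rightarrow> 'k set) \<Rightarrow> (nat \<Rightarrow> 'k) \<Rightarrow> bool" where
  "lifts V \<epsilon> e \<longleftrightarrow> (\<forall>i\<in>V. e i \<in> \<O> \<and> \<epsilon> i = \<pi> (e i))"

lemma poly_funs_term:
  "f \<in> poly_funs V \<Longrightarrow> \<exists>t. wf_term L_R t \<and> term_vars t \<subseteq> V \<and>
     (\<forall>\<epsilon> e. lifts V \<epsilon> e \<longrightarrow> eval_term M_R \<epsilon> t = \<pi> (f e))"
proof (induction rule: poly_funs.induct)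
  case (var i)
  then show ?case by (intro exI[of _ "Var i"]) (auto simp: lifts_def)
next
  case (const c)
  then show ?case by (intro exI[of _ "App (Inr (\<pi> c)) []"]) (auto simp: carrier_R)
next
  case (add f g)
  then obtain s t where "wf_term L_R s" "term_vars s \<subseteq> V" "wf_term L_R t" "term_vars t \<subseteq> V"
    "\<forall>\<epsilon> e. lifts V \<epsilon> e \<longrightarrow> eval_term M_R \<epsilon> s = \<pi> (f e)"
    "\<forall>\<epsilon> e. lifts V \<epsilon> e \<longrightarrow> eval_term M_R \<epsilon> t = \<pi> (g e)" by blast
  moreover have "f e \<in> \<O>" "g e \<in> \<O>" if "lifts V \<epsilon> e" for \<epsilon> e
    using that add.hyps by (auto simp: lifts_def intro: poly_in_O)
  ultimately show ?case
    by (intro exI[of _ "App (Inl Plus) [s, t]"])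
       (auto simp: L_ring_def ring_structure_def pi_add eval_nat_numeral)
next
  case (mult f g)
  then obtain s t where "wf_term L_R s" "term_vars s \<subseteq> V" "wf_term L_R t" "term_vars t \<subseteq> V"
    "\<forall>\<epsilon> e. lifts V \<epsilon> e \<longrightarrow> eval_term M_R \<epsilon> s = \<pi> (f e)"
    "\<forall>\<epsilon> e. lifts V \<epsilon> e \<longrightarrow> eval_term M_R \<epsilon> t = \<pi> (g e)" by blast
  moreover have "f e \<in> \<O>" "g e \<in> \<O>" if "lifts V \<epsilon> e" for \<epsilon> e
    using that mult.hyps by (auto simp: lifts_def intro: poly_in_O)
  ultimately show ?case
    by (intro exI[of _ "App (Inl Times) [s, t]"])
       (auto simp: L_ring_def ring_structure_def pi_mult eval_nat_numeral)
qed

definition ring_definable :: "nat set \<Rightarrow> ((nat \<Rightarrow> 'k) \<Rightarrow> bool) \<Rightarrow> bool" where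
  "ring_definable V Q \<longleftrightarrow> (\<exists>\<phi>. wf_formula L_R \<phi> \<and> free_vars \<phi> \<subseteq> V \<and>
     (\<forall>\<epsilon> e. lifts V \<epsilon> e \<longrightarrow> sat M_R \<epsilon> \<phi> = Q e))"

lemma ring_definable_cong:
  "ring_definable V Q \<Longrightarrow> (\<And>e. \<forall>i\<in>V. e i \<in> \<O> \<Longrightarrow> Q' e = Q e) \<Longrightarrow> ring_definable V Q'"
  unfolding ring_definable_def lifts_def by meson

lemma ring_definable_eq:
  assumes f: "f \<in> poly_funs V" and g: "g \<in> poly_funs V"
  shows "ring_definable V (\<lambda>e. pcong 1 (f e) (g e))"
proof -
  obtain s t where "wf_term L_R s" "term_vars s \<subseteq> V" "wf_term L_R t" "term_vars t \<subseteq> V"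
    and eval: "\<forall>\<epsilon> e. lifts V \<epsilon> e \<longrightarrow> eval_term M_R \<epsilon> s = \<pi> (f e)"
    "\<forall>\<epsilon> e. lifts V \<epsilon> e \<longrightarrow> eval_term M_R \<epsilon> t = \<pi> (g e)"
    using poly_funs_term[OF f] poly_funs_term[OF g] by blast
  moreover have "\<pi> (f e) = \<pi> (g e) \<longleftrightarrow> pcong 1 (f e) (g e)" if "lifts V \<epsilon> e" for \<epsilon> e
    using that f g by (intro pi_eq_iff) (auto simp: lifts_def intro: poly_in_O)
  ultimately show ?thesis
    unfolding ring_definable_def by (intro exI[of _ "Eq s t"]) auto
qed

lemma ring_definable_conj:
  assumes "ring_definable V Q1" "ring_definable V Q2"
  shows "ring_definable V (\<lambda>e. Q1 e \<and> Q2 e)"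
proof -
  obtain \<phi>1 where 1: "wf_formula L_R \<phi>1" "free_vars \<phi>1 \<subseteq> V"
    "\<forall>\<epsilon> e. lifts V \<epsilon> e \<longrightarrow> sat M_R \<epsilon> \<phi>1 = Q1 e"
    using assms(1) unfolding ring_definable_def by blast
  obtain \<phi>2 where 2: "wf_formula L_R \<phi>2" "free_vars \<phi>2 \<subseteq> V"
    "\<forall>\<epsilon> e. lifts V \<epsilon> e \<longrightarrow> sat M_R \<epsilon> \<phi>2 = Q2 e"
    using assms(2) unfolding ring_definable_def by blast
  show ?thesis unfolding ring_definable_def using 1 2 by (intro exI[of _ "Conj \<phi>1 \<phi>2"]) auto
qed

lemma ring_definable_ex:
  assumes "ring_definable (insert i V) Q"
  shows "ring_definable V (\<lambda>e. \<exists>b\<in>\<O>. Q (e(i := b)))"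
proof -
  obtain \<phi> where \<phi>: "wf_formula L_R \<phi>" "free_vars \<phi> \<subseteq> insert i V"
    "\<And>\<epsilon> e. lifts (insert i V) \<epsilon> e \<Longrightarrow> sat M_R \<epsilon> \<phi> = Q e"
    using assms unfolding ring_definable_def by blast
  have "sat M_R (\<epsilon>(i := \<pi> b)) \<phi> = Q (e(i := b))" if "lifts V \<epsilon> e" "b \<in> \<O>" for \<epsilon> e b
    using that by (intro \<phi>(3)) (auto simp: lifts_def)
  then show ?thesis unfolding ring_definable_def using \<phi>(1,2)
    by (intro exI[of _ "Exi i \<phi>"]) (auto simp: ring_structure_def carrier_R)
qed

text \<open>
  The polynomials are arbitrary, so that in the inductive step the coordinates of the representable
  functions on both sides, which involve the new variable, can be inserted.  Finiteness of \<open>V\<close>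
  provides that fresh variable.
\<close>

lemma ring_definable_ghost_pcong:
  assumes "finite V" "\<And>i. i < n \<Longrightarrow> x i \<in> poly_funs V" "\<And>i. i < n \<Longrightarrow> y i \<in> poly_funs V"
  shows "ring_definable V (\<lambda>e. pcong n (ghost n (\<lambda>i. x i e)) (ghost n (\<lambda>i. y i e)))"
  using assms
proof (induction n arbitrary: V x y)
  case 0
  show ?case
    by (rule ring_definable_cong[OF ring_definable_eq[of "\<lambda>_. 0" _ "\<lambda>_. 0"]])
       (auto intro: poly_funs.const)
next
  case (Suc n)
  obtain i where i: "i \<notin> V" using ex_new_if_finite[OF infinite_UNIV_nat Suc.prems(1)] by blast
  obtain w u where w: "w \<in> \<O>" "unit u" "w ^ p ^ n = P * u" using root_of_p by blast
  define X where "X e = ghost n (\<lambda>j. x (Suc j) e)" for e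
  define Y where "Y e = ghost n (\<lambda>j. y (Suc j) e)" for e
  let ?W = "insert i V"
  have xW: "x j \<in> poly_funs ?W" and yW: "y j \<in> poly_funs ?W" if "j < Suc n" for j
    using Suc.prems(2,3)[OF that] by (auto intro: poly_mono)
  have z: "(\<lambda>e. e i) \<in> poly_funs ?W" by (rule poly_funs.var) simp
  then have wz: "(\<lambda>e. w * e i) \<in> poly_funs ?W" using w(1) by (intro poly_funs.mult poly_funs.const)
  have repX: "representable n ?W X" and repY: "representable n ?W Y"
    unfolding X_def[abs_def] Y_def[abs_def] using xW yW by (auto intro!: representable_ghost)
  have "representable n ?W (\<lambda>e. u * e i ^ p ^ n + X e + carry n (y 0 e) (w * e i))"
    using w(2) z wz yW repX
    by (intro representable_add representable_const_mult_power representable_carry) (auto simp: unit_def)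
  then obtain x' where x': "\<And>j. j < n \<Longrightarrow> x' j \<in> poly_funs ?W"
    "\<And>e. \<forall>i\<in>?W. e i \<in> \<O> \<Longrightarrow>
      pcong n (u * e i ^ p ^ n + X e + carry n (y 0 e) (w * e i)) (ghost n (\<lambda>j. x' j e))"
    unfolding representable_def by blast
  have "ring_definable ?W (\<lambda>e. pcong n (ghost n (\<lambda>j. x' j e)) (Y e))"
    unfolding Y_def using Suc.prems(1) x'(1) yW by (intro Suc.IH) auto
  then have "ring_definable ?W
      (\<lambda>e. pcong n (u * e i ^ p ^ n + X e + carry n (y 0 e) (w * e i)) (Y e))"
    by (rule ring_definable_cong) (intro pcong_trans_iff x'(2) pcong_refl)
  moreover have "ring_definable ?W (\<lambda>e. pcong 1 (x 0 e) (y 0 e + w * e i))"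
    using xW yW wz by (intro ring_definable_eq poly_funs.add) auto
  ultimately have "ring_definable ?W (\<lambda>e. pcong 1 (x 0 e) (y 0 e + w * e i) \<and>
      pcong n (u * e i ^ p ^ n + X e + carry n (y 0 e) (w * e i)) (Y e))"
    by (intro ring_definable_conj)
  from ring_definable_ex[OF this] show ?case
  proof (rule ring_definable_cong)
    fix e :: "nat \<Rightarrow> 'k" assume e: "\<forall>i\<in>V. e i \<in> \<O>"
    have upd: "x j (e(i := b)) = x j e" "y j (e(i := b)) = y j e" if "j < Suc n" for j b
      using Suc.prems(2,3)[OF that] i by (auto intro: poly_fun_upd)
    then have "X (e(i := b)) = X e" "Y (e(i := b)) = Y e" for b
      unfolding X_def Y_def by (auto intro: ghost_cong)
    moreover have in_O: "x j e \<in> \<O>" "y j e \<in> \<O>" if "j < Suc n" for j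
      using Suc.prems(2,3)[OF that] e by (auto intro: poly_in_O)
    moreover have "X e \<in> \<O>" "Y e \<in> \<O>"
      unfolding X_def Y_def using in_O by (auto intro: ghost_in_O)
    ultimately show "pcong (Suc n) (ghost (Suc n) (\<lambda>i. x i e)) (ghost (Suc n) (\<lambda>i. y i e)) \<longleftrightarrow>
      (\<exists>b\<in>\<O>. pcong 1 (x 0 (e(i := b))) (y 0 (e(i := b)) + w * (e(i := b)) i) \<and>
        pcong n (u * (e(i := b)) i ^ p ^ n + X (e(i := b)) +
          carry n (y 0 (e(i := b))) (w * (e(i := b)) i)) (Y (e(i := b))))"
      using upd[of 0] ghost_pcong_Suc_iff[OF w, of "x 0 e" "y 0 e" "X e" "Y e"]
      by (simp add: ghost_Suc X_def[symmetric] Y_def[symmetric])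
  qed
qed

section \<open>Replacing the kernel symbols in formulas\<close>

lemma ring_term_poly_funs:
  assumes "wf_term L_Witt t" "term_vars t \<subseteq> V"
  shows "\<exists>f\<in>poly_funs V. \<forall>\<epsilon> e. lifts V \<epsilon> e \<longrightarrow> eval_term (witt_structure v p) \<epsilon> t = \<pi> (f e)"
  using assms
proof (induction t)
  case (Var i)
  then show ?case by (intro bexI[of _ "\<lambda>e. e i"]) (auto simp: lifts_def intro: poly_funs.var)
next
  case (App h ts)
  have "\<forall>t\<in>set ts. \<exists>f. f \<in> poly_funs V \<and>
      (\<forall>\<epsilon> e. lifts V \<epsilon> e \<longrightarrow> eval_term (witt_structure v p) \<epsilon> t = \<pi> (f e))"
  proof
    fix t assume t: "t \<in> set ts"
    have "wf_term L_Witt t" "term_vars t \<subseteq> V" using App.prems t by (auto simp: list_all_iff)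
    with App.IH[OF t] show "\<exists>f. f \<in> poly_funs V \<and>
      (\<forall>\<epsilon> e. lifts V \<epsilon> e \<longrightarrow> eval_term (witt_structure v p) \<epsilon> t = \<pi> (f e))" by blast
  qed
  then obtain F where F: "\<And>t. t \<in> set ts \<Longrightarrow> F t \<in> poly_funs V"
    "\<And>t \<epsilon> e. t \<in> set ts \<Longrightarrow> lifts V \<epsilon> e \<Longrightarrow> eval_term (witt_structure v p) \<epsilon> t = \<pi> (F t e)"
    by metis
  have in_O: "F t e \<in> \<O>" if "t \<in> set ts" "lifts V \<epsilon> e" for t \<epsilon> e
    using F(1)[OF that(1)] that(2) by (auto simp: lifts_def intro: poly_in_O)
  have interp: "fun_interp (witt_structure v p) = ring_fun_interp R"
    by (simp add: witt_structure_def ring_structure_def)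
  have "(h, length ts) \<in> {(Plus, 2), (Times, 2), (Minus, 1), (Zero, 0), (One, 0)}"
    using App.prems(1) by (simp add: L_Witt_def L_ring_def)
  then consider (Plus) "h = Plus" "length ts = 2" | (Times) "h = Times" "length ts = 2"
    | (Minus) "h = Minus" "length ts = 1" | (Zero) "h = Zero" | (One) "h = One" by auto
  then show ?case
  proof cases
    case Plus
    then obtain s t where ts: "ts = [s, t]" by (auto simp: numeral_2_eq_2 length_Suc_conv)
    then show ?thesis using Plus F in_O[of s] in_O[of t]
      by (intro bexI[of _ "\<lambda>e. F s e + F t e"]) (auto simp: interp pi_add intro: poly_funs.add)
  next
    case Times
    then obtain s t where ts: "ts = [s, t]" by (auto simp: numeral_2_eq_2 length_Suc_conv)
    then show ?thesis using Times F in_O[of s] in_O[of t]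
      by (intro bexI[of _ "\<lambda>e. F s e * F t e"]) (auto simp: interp pi_mult intro: poly_funs.mult)
  next
    case Minus
    then obtain t where ts: "ts = [t]" by (auto simp: length_Suc_conv)
    then show ?thesis using Minus F in_O[of t] poly_funs.mult[OF poly_funs.const[of "- 1"], of "F t" V]
      by (intro bexI[of _ "\<lambda>e. - 1 * F t e"]) (auto simp: interp pi_minus)
  next
    case Zero
    then show ?thesis by (intro bexI[of _ "\<lambda>e. 0"]) (auto simp: interp pi_zero intro: poly_funs.const)
  next
    case One
    then show ?thesis by (intro bexI[of _ "\<lambda>e. 1"]) (auto simp: interp pi_one intro: poly_funs.const)
  qed
qed

lemma witt_map_eq_iff:
  assumes n: "n \<ge> 1"
    and x: "\<And>i. i < n \<Longrightarrow> x i \<in> \<O> \<and> X ! i = \<pi> (x i)"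
    and y: "\<And>i. i < n \<Longrightarrow> y i \<in> \<O> \<and> Y ! i = \<pi> (y i)"
  shows "witt_map v p n X = witt_map v p n Y \<longleftrightarrow> pcong n (ghost n x) (ghost n y)"
proof -
  have "witt_map v p n X = PIdl\<^bsub>val_ring v\<^esub> (P ^ n) +>\<^bsub>val_ring v\<^esub> ghost n x"
    using witt_map_eq[OF val prime n, of x X] x witt_poly_eq_ghost[OF n] by simp
  moreover have "witt_map v p n Y = PIdl\<^bsub>val_ring v\<^esub> (P ^ n) +>\<^bsub>val_ring v\<^esub> ghost n y"
    using witt_map_eq[OF val prime n, of y Y] y witt_poly_eq_ghost[OF n] by simp
  moreover have "ghost n x \<in> \<O>" "ghost n y \<in> \<O>" using x y by (auto intro: ghost_in_O)
  ultimately show ?thesis by (simp add: coset_eq_iff[OF val] pcong_def)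
qed

lemma obtain_lift:
  assumes "\<forall>i\<in>V. \<epsilon> i \<in> carrier R"
  obtains e where "lifts V \<epsilon> e"
proof -
  have "\<forall>i\<in>V. \<exists>a\<in>\<O>. \<epsilon> i = \<pi> a" using assms by (auto simp: carrier_R)
  then show ?thesis using that unfolding lifts_def by metis
qed

text \<open>
  Agreement of the assignments is asked for on \<open>V\<close> only, because \<^const>\<open>definable\<close> evaluates
  formulas at assignments \<open>(xs @ bs) ! i\<close>, which are unspecified beyond the length of the list.
\<close>

definition translates ::
    "nat set \<Rightarrow> (ring_sym + 'k set, witt_sym) fo_formula \<Rightarrow> (ring_sym, witt_sym) fo_formula \<Rightarrow> bool" where
  "translates V \<psi> \<phi> \<longleftrightarrow> wf_formula L_R \<psi> \<and> free_vars \<psi> \<subseteq> V \<and>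
    (\<forall>\<epsilon> \<epsilon>'. (\<forall>i\<in>V. \<epsilon> i \<in> carrier R \<and> \<epsilon>' i = \<epsilon> i) \<longrightarrow>
      sat M_R \<epsilon> \<psi> = sat (witt_structure v p) \<epsilon>' \<phi>)"

lemma translatesI:
  assumes "wf_formula L_R \<psi>" "free_vars \<psi> \<subseteq> V"
    and "\<And>\<epsilon> \<epsilon>'. \<forall>i\<in>V. \<epsilon> i \<in> carrier R \<and> \<epsilon>' i = \<epsilon> i \<Longrightarrow>
      sat M_R \<epsilon> \<psi> = sat (witt_structure v p) \<epsilon>' \<phi>"
  shows "translates V \<psi> \<phi>"
  using assms unfolding translates_def by blast

lemma translates_sat:
  "translates V \<psi> \<phi> \<Longrightarrow> \<forall>i\<in>V. \<epsilon> i \<in> carrier R \<and> \<epsilon>' i = \<epsilon> i \<Longrightarrow>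
    sat M_R \<epsilon> \<psi> = sat (witt_structure v p) \<epsilon>' \<phi>"
  unfolding translates_def by blast

lemma translates_of_ring_definable:
  assumes Q: "ring_definable V Q"
    and sat: "\<And>\<epsilon> e. lifts V \<epsilon> e \<Longrightarrow> sat (witt_structure v p) \<epsilon> \<phi> = Q e"
  shows "\<exists>\<psi>. translates V \<psi> \<phi>"
proof -
  obtain \<psi> where \<psi>: "wf_formula L_R \<psi>" "free_vars \<psi> \<subseteq> V"
    "\<And>\<epsilon> e. lifts V \<epsilon> e \<Longrightarrow> sat M_R \<epsilon> \<psi> = Q e"
    using Q unfolding ring_definable_def by blast
  have "translates V \<psi> \<phi>"
  proof (rule translatesI[OF \<psi>(1,2)])
    fix \<epsilon> \<epsilon>' assume \<epsilon>: "\<forall>i\<in>V. \<epsilon> i \<in> carrier R \<and> \<epsilon>' i = \<epsilon> i"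
    then obtain e where e: "lifts V \<epsilon> e" using obtain_lift by blast
    then have "lifts V \<epsilon>' e" using \<epsilon> by (simp add: lifts_def)
    then show "sat M_R \<epsilon> \<psi> = sat (witt_structure v p) \<epsilon>' \<phi>" using \<psi>(3)[OF e] sat by simp
  qed
  then show ?thesis by blast
qed

lemma translation:
  assumes "finite V" "wf_formula L_Witt \<phi>" "free_vars \<phi> \<subseteq> V"
  shows "\<exists>\<psi>. translates V \<psi> \<phi>"
  using assms
proof (induction \<phi> arbitrary: V)
  case (Eq s t)
  then obtain f g where fg: "f \<in> poly_funs V" "g \<in> poly_funs V"
    "\<And>\<epsilon> e. lifts V \<epsilon> e \<Longrightarrow> eval_term (witt_structure v p) \<epsilon> s = \<pi> (f e)"
    "\<And>\<epsilon> e. lifts V \<epsilon> e \<Longrightarrow> eval_term (witt_structure v p) \<epsilon> t = \<pi> (g e)"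
    using ring_term_poly_funs[of s V] ring_term_poly_funs[of t V] by auto
  show ?case
  proof (rule translates_of_ring_definable[OF ring_definable_eq[OF fg(1,2)]])
    fix \<epsilon> e assume e: "lifts V \<epsilon> e"
    have "f e \<in> \<O>" "g e \<in> \<O>" using e fg(1,2) by (auto simp: lifts_def intro: poly_in_O)
    then show "sat (witt_structure v p) \<epsilon> (Eq s t) = pcong 1 (f e) (g e)"
      using fg(3,4)[OF e] pi_eq_iff by simp
  qed
next
  case (Rel r ts)
  then obtain n where n: "n \<ge> 1" "r = Ker n" "length ts = 2 * n" by (auto simp: L_Witt_def)
  have "\<forall>j. j < 2 * n \<longrightarrow> (\<exists>f. f \<in> poly_funs V \<and>
      (\<forall>\<epsilon> e. lifts V \<epsilon> e \<longrightarrow> eval_term (witt_structure v p) \<epsilon> (ts ! j) = \<pi> (f e)))"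
  proof (intro allI impI)
    fix j assume "j < 2 * n"
    then have "ts ! j \<in> set ts" using n by simp
    then show "\<exists>f. f \<in> poly_funs V \<and>
        (\<forall>\<epsilon> e. lifts V \<epsilon> e \<longrightarrow> eval_term (witt_structure v p) \<epsilon> (ts ! j) = \<pi> (f e))"
      using ring_term_poly_funs[of "ts ! j" V] Rel.prems by (simp add: list_all_iff UN_subset_iff Bex_def)
  qed
  then obtain F where F: "\<And>j. j < 2 * n \<Longrightarrow> F j \<in> poly_funs V"
    "\<And>j \<epsilon> e. j < 2 * n \<Longrightarrow> lifts V \<epsilon> e \<Longrightarrow> eval_term (witt_structure v p) \<epsilon> (ts ! j) = \<pi> (F j e)"
    by metis
  have "ring_definable V (\<lambda>e. pcong n (ghost n (\<lambda>i. F i e)) (ghost n (\<lambda>i. F (n + i) e)))"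
    using Rel.prems(1) F(1) by (intro ring_definable_ghost_pcong) auto
  then show ?case
  proof (rule translates_of_ring_definable)
    fix \<epsilon> e assume e: "lifts V \<epsilon> e"
    have in_O: "F j e \<in> \<O>" if "j < 2 * n" for j
      using e F(1)[OF that] by (auto simp: lifts_def intro: poly_in_O)
    define zs where "zs = map (eval_term (witt_structure v p) \<epsilon>) ts"
    have len: "length zs = 2 * n" using n(3) by (simp add: zs_def)
    have zs: "zs ! j = \<pi> (F j e)" if "j < 2 * n" for j
      using F(2)[OF that e] that n(3) by (simp add: zs_def)
    have "witt_map v p n (take n zs) = witt_map v p n (drop n zs) \<longleftrightarrow>
        pcong n (ghost n (\<lambda>i. F i e)) (ghost n (\<lambda>i. F (n + i) e))"
      using len by (intro witt_map_eq_iff[OF n(1)]) (auto simp: zs in_O)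
    then show "sat (witt_structure v p) \<epsilon> (Rel r ts) =
        pcong n (ghost n (\<lambda>i. F i e)) (ghost n (\<lambda>i. F (n + i) e))"
      by (simp add: n(2) witt_structure_def zs_def)
  qed
next
  case (Neg \<phi>)
  have "wf_formula L_Witt \<phi>" "free_vars \<phi> \<subseteq> V" using Neg.prems by auto
  from Neg.IH[OF Neg.prems(1) this] obtain \<psi> where "translates V \<psi> \<phi>" by blast
  then have "translates V (Neg \<psi>) (Neg \<phi>)" by (auto simp: translates_def)
  then show ?case by blast
next
  case (Conj \<phi>1 \<phi>2)
  have prems: "wf_formula L_Witt \<phi>1" "free_vars \<phi>1 \<subseteq> V" "wf_formula L_Witt \<phi>2" "free_vars \<phi>2 \<subseteq> V"
    using Conj.prems by auto
  obtain \<psi>1 \<psi>2 where \<psi>: "translates V \<psi>1 \<phi>1" "translates V \<psi>2 \<phi>2"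
    using Conj.IH(1)[OF Conj.prems(1) prems(1,2)] Conj.IH(2)[OF Conj.prems(1) prems(3,4)] by blast
  have "translates V (Conj \<psi>1 \<psi>2) (Conj \<phi>1 \<phi>2)"
  proof (rule translatesI)
    fix \<epsilon> \<epsilon>' assume "\<forall>i\<in>V. \<epsilon> i \<in> carrier R \<and> \<epsilon>' i = \<epsilon> i"
    from translates_sat[OF \<psi>(1) this] translates_sat[OF \<psi>(2) this]
    show "sat M_R \<epsilon> (Conj \<psi>1 \<psi>2) = sat (witt_structure v p) \<epsilon>' (Conj \<phi>1 \<phi>2)" by simp
  qed (use \<psi> in \<open>auto simp: translates_def\<close>)
  then show ?case by blast
next
  case (Exi i \<phi>)
  have "finite (insert i V)" "wf_formula L_Witt \<phi>" "free_vars \<phi> \<subseteq> insert i V"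
    using Exi.prems by auto
  from Exi.IH[OF this] obtain \<psi> where \<psi>: "translates (insert i V) \<psi> \<phi>" by blast
  have "translates V (Exi i \<psi>) (Exi i \<phi>)"
  proof (rule translatesI)
    fix \<epsilon> \<epsilon>' assume "\<forall>j\<in>V. \<epsilon> j \<in> carrier R \<and> \<epsilon>' j = \<epsilon> j"
    then have "sat M_R (\<epsilon>(i := a)) \<psi> = sat (witt_structure v p) (\<epsilon>'(i := a)) \<phi>"
      if "a \<in> carrier R" for a
      using that by (intro translates_sat[OF \<psi>]) auto
    then show "sat M_R \<epsilon> (Exi i \<psi>) = sat (witt_structure v p) \<epsilon>' (Exi i \<phi>)"
      by (simp add: ring_structure_def witt_structure_def)
  qed (use \<psi> in \<open>auto simp: translates_def\<close>)
  then show ?case by blast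
qed

end

theorem proposition3p11:
  fixes v :: "'k::field \<Rightarrow> 'g::linordered_ab_group_add"
    and p n :: nat
    and S :: "'k set list set"
  assumes "prime p"
    and "valuation v"
    and "mixed_characteristic v p"
    and "roughly_deeply_ramified v p"
    and "n \<ge> 1"
    and "definable L_Witt (witt_structure v p) {} n S"
  shows "definable L_ring (ring_structure (val_ring_mod v (of_nat p)))
           (carrier (val_ring_mod v (of_nat p))) n S"
proof -
  have "of_nat p \<noteq> (0 :: 'k)"
    using assms(1,3) by (simp add: mixed_characteristic_def of_nat_eq_0_iff_char_dvd)
  then interpret ramified_valued_field v p
    using assms by unfold_locales
  have U: "universe (witt_structure v p) = carrier R" "universe (ring_structure R) = carrier R"
    by (simp_all add: witt_structure_def ring_structure_def)
  obtain \<phi> where \<phi>: "wf_formula L_Witt \<phi>" "free_vars \<phi> \<subseteq> {..<n}"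
    "S = {xs. length xs = n \<and> set xs \<subseteq> carrier R \<and> sat (witt_structure v p) (\<lambda>i. xs ! i) \<phi>}"
    using assms(6) unfolding definable_def U by auto
  obtain \<psi> where \<psi>: "translates {..<n} \<psi> \<phi>" using translation[OF _ \<phi>(1,2)] by auto
  show ?thesis
  proof (rule definable_of_formula_with_consts)
    show "wf_formula L_R \<psi>" "free_vars \<psi> \<subseteq> {..<n}" using \<psi> by (auto simp: translates_def)
    show "length xs = n \<and> set xs \<subseteq> universe (ring_structure R)" if "xs \<in> S" for xs
      using that unfolding \<phi>(3) U by simp
    show "sat M_R \<epsilon> \<psi> \<longleftrightarrow> xs \<in> S"
      if xs: "length xs = n" "set xs \<subseteq> universe (ring_structure R)" "\<forall>i<n. \<epsilon> i = xs ! i" for xs \<epsilon>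
    proof -
      have "sat M_R \<epsilon> \<psi> = sat (witt_structure v p) (\<lambda>i. xs ! i) \<phi>"
        using xs unfolding U by (intro translates_sat[OF \<psi>]) auto
      then show ?thesis using xs unfolding \<phi>(3) U by simp
    qed
  qed
qed

end
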